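(* Let $w_1$ and $w_2$ be classical scalar weights of the same type (both shifted Hermite, both Laguerre, or both Jacobi). Then $w_1$ is a Darboux transformation of $w_2$ if and only if $\mathcal D(w_1,w_2)\neq 0$.
   Context: Classical scalar weights: shifted Hermite $w_b(x)=e^{-x^2+2bx}$ on $(-\infty,\infty)$, $b\in\mathbb R$; Laguerre $w_\alpha(x)=e^{-x}x^\alpha$ on $(0,\infty)$, $\alpha>-1$; Jacobi $w_{\alpha,\beta}(x)=(1-x)^\alpha(1+x)^\beta$ on $(-1,1)$, $\alpha,\beta>-1$. Differential operators $D=\sum_{j}\partial^jf_j(x)$ with $f_j\in\mathbb C[x]$, $\partial=\frac{d}{dx}$, act on the right on functions: $p(x)\cdot D=\sum_j p^{(j)}(x)f_j(x)$; products satisfy $p\cdot(D_1D_2)=(p\cdot D_1)\cdot D_2$. The algebra of these operators is denoted $\Omega[x]$. For scalar weights $w_1,w_2$ with monic orthogonal polynomials $p_n^{w_1},p_n^{w_2}$, $$\mathcal D(w_1,w_2)=\{\mathcal T\in\Omega[x] : p_n^{w_1}\cdot\mathcal T=\Lambda_n(\mathcal T)p_n^{w_2},\ \Lambda_n(\mathcal T)\in\mathbb C,\ \text{for all } n\ge0\},$$ and $\mathcal D(w)=\mathcal D(w,w)$. An operator $\mathcal V\in\Omega[x]$ is degree-preserving if $\deg(p\cdot\mathcal V)=\deg p$ for all $p\in\mathbb C[x]$. For scalar weights $w,\widetilde w$ on the same interval with monic orthogonal polynomials $p_n,\widetilde p_n$, $\widetilde w$ is a Darboux transformation of $w$ if there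 is $D\in\mathcal D(w)$ with $D=\mathcal V\mathcal N$, where $\mathcal V,\mathcal N\in\Omega[x]$ are degree-preserving and $p_n\cdot\mathcal V=A_n\widetilde p_n$ for all $n\in\mathbb N_0$, for some $A_n\in\mathbb C$. *)

theory Defs
  imports "HOL-Analysis.Analysis" "HOL-Computational_Algebra.Polynomial"
begin

subsection \<open>Scalar weights\<close>

text \<open>A weight carries its interval; values of the density off the interval are irrelevant.\<close>

datatype scalar_weight = Scalar_Weight (interval: "real set") (density: "real \<Rightarrow> real")

definition hermite_weight :: "real \<Rightarrow> scalar_weight" where
  "hermite_weight b = Scalar_Weight UNIV (\<lambda>x. exp (- x\<^sup>2 + 2 * b * x))"

definition laguerre_weight :: "real \<Rightarrow> scalar_weight" where
  "laguerre_weight \<alpha> = Scalar_Weight {0<..} (\<lambda>x. exp (- x) * x powr \<alpha>)"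

definition jacobi_weight :: "real \<Rightarrow> real \<Rightarrow> scalar_weight" where
  "jacobi_weight \<alpha> \<beta> =
     Scalar_Weight {-1<..<1} (\<lambda>x. (1 - x) powr \<alpha> * (1 + x) powr \<beta>)"

definition hermite_weights :: "scalar_weight set" where
  "hermite_weights = {hermite_weight b | b. True}"

definition laguerre_weights :: "scalar_weight set" where
  "laguerre_weights = {laguerre_weight \<alpha> | \<alpha>. \<alpha> > -1}"

definition jacobi_weights :: "scalar_weight set" where
  "jacobi_weights = {jacobi_weight \<alpha> \<beta> | \<alpha> \<beta>. \<alpha> > -1 \<and> \<beta> > -1}"

subsection \<open>Monic orthogonal polynomials\<close>

definition weight_inner :: "scalar_weight \<Rightarrow> complex poly \<Rightarrow> complex poly \<Rightarrow> complex" where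
  "weight_inner w p q =
     (LINT x:interval w|lborel.
        poly p (of_real x) * complex_of_real (density w x) * cnj (poly q (of_real x)))"

definition is_monic_orthogonal :: "scalar_weight \<Rightarrow> (nat \<Rightarrow> complex poly) \<Rightarrow> bool" where
  "is_monic_orthogonal w p \<longleftrightarrow>
     (\<forall>n. degree (p n) = n \<and> lead_coeff (p n) = 1) \<and>
     (\<forall>m n. m \<noteq> n \<longrightarrow> weight_inner w (p m) (p n) = 0)"

definition monic_orthogonal :: "scalar_weight \<Rightarrow> nat \<Rightarrow> complex poly" where
  "monic_orthogonal w = (THE p. is_monic_orthogonal w p)"

subsection \<open>Differential operators with polynomial coefficients\<close>

text \<open>The coefficient sequence \<open>f\<close> (a polynomial in the symbol of the derivation, only used to
  encode a finite sequence) stands for the operator \<open>\<Sum>j. \<partial>^j f\<^sub>j(x)\<close> acting on the right.\<close>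

definition diffop :: "complex poly poly \<Rightarrow> complex poly \<Rightarrow> complex poly" where
  "diffop f p = (\<Sum>j\<le>degree f. (pderiv ^^ j) p * coeff f j)"

text \<open>Operators are identified with the maps they induce on polynomials; this is legitimate by
  \<open>inj_diffop\<close>. Since the action is on the right, the product \<open>D\<^sub>1D\<^sub>2\<close> is the map
  \<open>D\<^sub>2 \<circ> D\<^sub>1\<close>, and \<open>diffops_comp\<close> shows that it is again such an operator.\<close>

definition diffops :: "(complex poly \<Rightarrow> complex poly) set" where
  "diffops = range diffop"

abbreviation diffop_mult ::
    "(complex poly \<Rightarrow> complex poly) \<Rightarrow> (complex poly \<Rightarrow> complex poly)
      \<Rightarrow> (complex poly \<Rightarrow> complex poly)" (infixl "\<cdot>\<^sub>\<Omega>" 70) where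
  "D1 \<cdot>\<^sub>\<Omega> D2 \<equiv> D2 \<circ> D1"

lemma diffop_eq_sum:
  assumes "degree f \<le> N"
  shows "diffop f p = (\<Sum>j\<le>N. (pderiv ^^ j) p * coeff f j)"
  unfolding diffop_def
  by (rule sum.mono_neutral_left) (use assms in \<open>auto simp: coeff_eq_0\<close>)

lemma diffop_add: "diffop (f + g) p = diffop f p + diffop g p"
proof -
  define N where "N = max (degree f) (degree g)"
  have "degree (f + g) \<le> N" "degree f \<le> N" "degree g \<le> N"
    by (auto simp: N_def degree_add_le_max)
  then show ?thesis
    by (simp add: diffop_eq_sum[where N = N] sum.distrib distrib_left)
qed

lemma diffop_zero [simp]: "diffop 0 = (\<lambda>p. 0)"
  by (simp add: diffop_def fun_eq_iff)

lemma diffop_smult: "diffop (smult g f) p = diffop f p * g"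
  by (subst (1 2) diffop_eq_sum[where N = "degree f"])
     (auto simp: sum_distrib_left mult_ac degree_smult_le)

lemma pderiv_sum': "pderiv (\<Sum>j\<in>A. F j) = (\<Sum>j\<in>A. pderiv (F j))"
  by (induction A rule: infinite_finite_induct) (auto simp: pderiv_add)

lemma pderiv_diffop:
  "pderiv (diffop f p) = diffop (pCons 0 f + map_poly pderiv f) p"
proof -
  define N where "N = degree f"
  have N: "degree (pCons 0 f) \<le> Suc N" "degree (map_poly pderiv f) \<le> N"
    by (auto simp: N_def degree_pCons_le coeff_map_poly coeff_eq_0 intro!: degree_le)
  have "diffop (pCons 0 f) p = (\<Sum>j\<le>N. (pderiv ^^ Suc j) p * coeff f j)"
    by (subst diffop_eq_sum[OF N(1)], subst sum.atMost_Suc_shift) simp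
  moreover have "diffop (map_poly pderiv f) p = (\<Sum>j\<le>N. (pderiv ^^ j) p * pderiv (coeff f j))"
    by (subst diffop_eq_sum[OF N(2)]) (simp add: coeff_map_poly)
  moreover have "diffop f p = (\<Sum>j\<le>N. (pderiv ^^ j) p * coeff f j)"
    by (simp add: diffop_def N_def)
  ultimately show ?thesis
    by (simp add: diffop_add pderiv_sum' pderiv_mult sum.distrib[symmetric] algebra_simps)
qed

lemma diffops_add: "D \<in> diffops \<Longrightarrow> E \<in> diffops \<Longrightarrow> (\<lambda>p. D p + E p) \<in> diffops"
  unfolding diffops_def by (auto simp: image_iff fun_eq_iff diffop_add[symmetric])

lemma diffops_funpow_pderiv: "D \<in> diffops \<Longrightarrow> (\<lambda>p. (pderiv ^^ j) (D p)) \<in> diffops"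
proof (induction j)
  case (Suc j)
  then obtain f where "(\<lambda>p. (pderiv ^^ j) (D p)) = diffop f"
    by (auto simp: diffops_def)
  then have "(\<lambda>p. (pderiv ^^ Suc j) (D p)) = diffop (pCons 0 f + map_poly pderiv f)"
    by (simp add: fun_eq_iff pderiv_diffop)
  then show ?case by (auto simp: diffops_def)
qed simp

lemma diffops_mult_right: "D \<in> diffops \<Longrightarrow> (\<lambda>p. D p * g) \<in> diffops"
  unfolding diffops_def by (auto simp: image_iff fun_eq_iff diffop_smult[symmetric])

lemma diffops_sum:
  "finite A \<Longrightarrow> (\<And>j. j \<in> A \<Longrightarrow> D j \<in> diffops) \<Longrightarrow> (\<lambda>p. \<Sum>j\<in>A. D j p) \<in> diffops"
proof (induction A rule: finite_induct)
  case empty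
  show ?case by (auto simp: diffops_def intro!: image_eqI[of _ _ 0])
next
  case (insert x A)
  then show ?case using diffops_add[of "D x" "\<lambda>p. \<Sum>j\<in>A. D j p"] by simp
qed

lemma diffops_comp:
  assumes "D1 \<in> diffops" "D2 \<in> diffops"
  shows "D1 \<cdot>\<^sub>\<Omega> D2 \<in> diffops"
proof -
  obtain f where f: "D2 = diffop f" using assms(2) by (auto simp: diffops_def)
  have "D1 \<cdot>\<^sub>\<Omega> D2 = (\<lambda>p. \<Sum>j\<le>degree f. (pderiv ^^ j) (D1 p) * coeff f j)"
    by (simp add: f fun_eq_iff diffop_def)
  also have "\<dots> \<in> diffops"
    by (intro diffops_sum diffops_mult_right diffops_funpow_pderiv assms) auto
  finally show ?thesis .
qed

lemma diffop_eq_0D: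
  assumes "diffop f = (\<lambda>p. 0)"
  shows "f = 0"
proof (rule ccontr)
  assume "f \<noteq> 0"
  define k where "k = (LEAST j. coeff f j \<noteq> 0)"
  have ex: "\<exists>j. coeff f j \<noteq> 0" using \<open>f \<noteq> 0\<close> by (auto simp: poly_eq_iff)
  have k: "coeff f k \<noteq> 0" unfolding k_def by (rule LeastI_ex[OF ex])
  have less: "coeff f j = 0" if "j < k" for j using not_less_Least[of j] that by (auto simp: k_def)
  let ?p = "monom (1::complex) k"
  have hi: "(pderiv ^^ j) ?p = 0" if "k < j" for j
    using that by (intro poly_eqI) (simp add: coeff_higher_pderiv)
  have "diffop f ?p = (\<Sum>j\<in>{k}. (pderiv ^^ j) ?p * coeff f j)"
    unfolding diffop_def
  proof (rule sum.mono_neutral_right)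
    show "\<forall>i\<in>{..degree f} - {k}. (pderiv ^^ i) ?p * coeff f i = 0"
      using less hi by (metis DiffD2 insertI1 linorder_neqE_nat mult_eq_0_iff singletonD singletonI)
  qed (use k le_degree in auto)
  moreover have "coeff ((pderiv ^^ k) ?p) 0 \<noteq> 0"
    by (simp add: coeff_higher_pderiv flip: pochhammer_fact)
  ultimately have "diffop f ?p \<noteq> 0" using k by auto
  then show False using assms by simp
qed

lemma inj_diffop: "inj diffop"
proof (rule injI)
  fix f g assume "diffop f = diffop g"
  moreover have "diffop f p = diffop (f - g) p + diffop g p" for p
    using diffop_add[of "f - g" g p] by simp
  ultimately have "diffop (f - g) = (\<lambda>p. 0)" by (simp add: fun_eq_iff)
  then show "f = g" using diffop_eq_0D by fastforce
qed

subsection \<open>Intertwining operators and Darboux transformations\<close>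

definition intertwiners :: "scalar_weight \<Rightarrow> scalar_weight \<Rightarrow> (complex poly \<Rightarrow> complex poly) set" where
  "intertwiners w1 w2 =
     {T \<in> diffops. \<forall>n. \<exists>\<Lambda>::complex. T (monic_orthogonal w1 n) = smult \<Lambda> (monic_orthogonal w2 n)}"

text \<open>With the convention \<open>deg 0 = -\<infinity>\<close>, a degree-preserving operator kills no nonzero
  polynomial; as \<open>degree 0 = 0\<close> here, this has to be required separately for constants.\<close>

definition degree_preserving :: "(complex poly \<Rightarrow> complex poly) \<Rightarrow> bool" where
  "degree_preserving V \<longleftrightarrow> (\<forall>p. p \<noteq> 0 \<longrightarrow> V p \<noteq> 0 \<and> degree (V p) = degree p)"

definition darboux_transformation :: "scalar_weight \<Rightarrow> scalar_weight \<Rightarrow> bool"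
    (infix "is'_Darboux'_transformation'_of" 50) where
  "w' is_Darboux_transformation_of w \<longleftrightarrow>
     interval w' = interval w \<and>
     (\<exists>D \<in> intertwiners w w. \<exists>V \<in> diffops. \<exists>N \<in> diffops.
        degree_preserving V \<and> degree_preserving N \<and>
        D = V \<cdot>\<^sub>\<Omega> N \<and>
        (\<forall>n. \<exists>A::complex. V (monic_orthogonal w n) = smult A (monic_orthogonal w' n)))"

end

theory Submission
  imports Defs "HOL-Probability.Distributions" "HOL-Real_Asymp.Real_Asymp"
begin

text \<open>
The monic orthogonal polynomials \<open>p n\<close> of each weight are eigenfunctions of a second-order operator
\<open>\<delta> p = p'' a + p' b\<close> with \<open>deg a \<le> 2\<close>, \<open>deg b \<le> 1\<close>, for pairwise distinct eigenvalues \<open>e n\<close>. Within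
a type, \<open>a\<close> is fixed (\<open>1\<close>, \<open>x\<close> or \<open>1 - x\<^sup>2\<close>) and only \<open>b\<close> depends on the parameters. Distinctness
makes an eigenpolynomial of given degree unique up to scaling. So, when two weights have the same
eigenvalues, an operator \<open>T\<close> is an intertwiner exactly if it satisfies \<open>\<delta>\<^sub>1 T = T \<delta>\<^sub>2\<close>
(\<open>intertwiner_imp_commuting\<close>, \<open>commuting_imp_intertwiner\<close>). All questions then become algebraic.

A Darboux transformation gives an intertwiner at once: if \<open>V N\<close> is diagonal on the polynomials
of \<open>w2\<close> and \<open>V\<close> sends them to nonzero multiples of those of \<open>w1\<close>, then \<open>N\<close> sends the
latter back (\<open>Darboux_imp_intertwiner\<close>).

For the converse, a nonzero intertwiner forces the parameters to be related.

\<^item> If the eigenvalues agree, the second highest order of \<open>\<delta>\<^sub>1 T = T \<delta>\<^sub>2\<close> gives, for the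
  leading coefficient \<open>g\<close> of \<open>T\<close> and its order \<open>m\<close>, the equation \<open>m a' g + (b\<^sub>1 - b\<^sub>2) g = 2 a g'\<close>
  (\<open>leading_symbol_equation\<close>). A nonzero polynomial solution exists for Hermite weights only if the
  parameters coincide. For Laguerre weights the top coefficient of \<open>g\<close>, and for Jacobi weights the order
  of vanishing of \<open>g\<close> at 1, shows that \<open>\<alpha>\<^sub>1 - \<alpha>\<^sub>2\<close> is an integer.

\<^item> For Jacobi weights the eigenvalues \<open>- n (n + \<alpha> + \<beta> + 1)\<close> agree only if \<open>\<alpha> + \<beta>\<close> does, and this is
  forced as well (\<open>jacobi_intertwiner_parameter_sum\<close>). At the point 1 all derivatives of \<open>p n\<close> are
  polynomials in the eigenvalue times \<open>p n (1)\<close>, because the differential equation is singular there.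
  Hence so are value and slope of \<open>T (p n)\<close> at 1, say with factors \<open>M\<close> and \<open>K\<close>. Their ratio is
  fixed by the differential equation of the target weight, which gives an identity of the form
  \<open>s n M(e n) = \<dots>\<close>, with \<open>s\<close> the difference of the sums and only polynomials in \<open>e n\<close> on the right.
  As \<open>e n\<close> is quadratic in \<open>n\<close>, the left side has odd and the right side even degree in \<open>n\<close>, so
  \<open>s M = 0\<close>. If \<open>M = 0\<close>, all images \<open>T (p n)\<close> vanish at 1, where no eigenpolynomial does, and \<open>T = 0\<close>.

Conversely, parameters related in this way are equal, where the identity operator serves,
or joined by a chain of first-order ladder operators:
\<open>1 - \<partial>\<close> and \<open>x \<partial> + \<alpha> + 1\<close> for \<open>\<alpha> \<leftrightarrow> \<alpha> + 1\<close> in the Laguerre case, and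
\<open>(1 + x) \<partial> + \<beta>\<close> and \<open>(1 - x) \<partial> - (\<alpha> + 1)\<close> for \<open>(\<alpha>, \<beta>) \<leftrightarrow> (\<alpha> + 1, \<beta> - 1)\<close> in the Jacobi case.
Throughout the chain the parameters stay above \<open>-1\<close>, which keeps these operators degree-preserving, so
the composites along the chain, in both directions, form a Darboux transformation.
\<close>

section \<open>Differential operators on a monic basis\<close>

lemma diffops_linear:
  assumes "T \<in> diffops"
  shows "T (p + q) = T p + T q" "T (smult c p) = smult c (T p)" "T 0 = 0"
        "T (p - q) = T p - T q"
proof -
  obtain f where f: "T = diffop f" using assms by (auto simp: diffops_def)
  show add: "T (p + q) = T p + T q" for p q
    by (simp add: f diffop_def higher_pderiv_add distrib_right sum.distrib)
  show sm: "T (smult c p) = smult c (T p)" for c p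
  proof -
    have "[:c:] * (\<Sum>j\<le>degree f. (pderiv ^^ j) p * coeff f j) =
          (\<Sum>j\<le>degree f. [:c:] * ((pderiv ^^ j) p * coeff f j))" by (rule sum_distrib_left)
    thus ?thesis by (simp add: f diffop_def higher_pderiv_smult)
  qed
  show "T 0 = 0" by (simp add: f diffop_def)
  show "T (p - q) = T p - T q"
    using add[of p "smult (-1) q"] sm[of "-1" q] by simp
qed

text \<open>Polynomials of degree below \<open>n\<close> are combinations of the first \<open>n\<close> members of a monic
  sequence; in the form of an induction rule this serves both for operators and for
  orthogonality.\<close>

lemma monic_basis_induct:
  fixes P :: "nat \<Rightarrow> complex poly"
  assumes P: "\<And>j. degree (P j) = j" "\<And>j. lead_coeff (P j) = 1"
    and zero: "Q 0" and step: "\<And>c j r. j < n \<Longrightarrow> Q r \<Longrightarrow> Q (r + smult c (P j))"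
    and r: "r = 0 \<or> degree r < n"
  shows "Q r"
  using r
proof (induction "degree r" arbitrary: r rule: less_induct)
  case less
  show ?case
  proof (cases "r = 0")
    case False
    define d where "d = degree r"
    define s where "s = r - smult (lead_coeff r) (P d)"
    have dn: "d < n" using less.prems False by (simp add: d_def)
    have ds: "degree s \<le> d"
      unfolding s_def by (rule degree_diff_le) (auto simp: d_def P degree_smult_le)
    have "coeff s d = 0" using P(2)[of d] by (simp add: s_def P(1) d_def)
    hence "s = 0 \<or> degree s < d"
      by (metis ds leading_coeff_0_iff order_le_imp_less_or_eq)
    hence "Q s" using less.hyps[of s] zero dn by (auto simp: d_def)
    hence "Q (s + smult (lead_coeff r) (P d))" by (rule step[OF dn])
    thus ?thesis by (simp add: s_def)
  qed (simp add: zero)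
qed

lemma linear_eq_on_monic_basis:
  fixes P :: "nat \<Rightarrow> complex poly" and F G :: "complex poly \<Rightarrow> complex poly"
  assumes P: "\<And>j. degree (P j) = j" "\<And>j. lead_coeff (P j) = 1"
    and F: "\<And>p q. F (p + q) = F p + F q" "\<And>c p. F (smult c p) = smult c (F p)"
    and G: "\<And>p q. G (p + q) = G p + G q" "\<And>c p. G (smult c p) = smult c (G p)"
    and eq: "\<And>n. F (P n) = G (P n)"
  shows "F = G"
proof
  fix p
  have z: "F 0 = 0" "G 0 = 0" using F(2)[of 0 0] G(2)[of 0 0] by simp_all
  show "F p = G p"
    by (rule monic_basis_induct[OF P, of "\<lambda>p. F p = G p" "Suc (degree p)"])
       (simp_all add: F G eq z)
qed

section \<open>Second-order operators and their eigenpolynomials\<close>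

definition hypergeometric_op :: "real poly \<Rightarrow> real poly \<Rightarrow> complex poly \<Rightarrow> complex poly" where
  "hypergeometric_op a b p =
     pderiv (pderiv p) * map_poly of_real a + pderiv p * map_poly of_real b"

text \<open>The action of the operator on the top coefficient, see \<open>hypergeometric_op_top\<close>.\<close>

definition op_eigenvalue :: "real poly \<Rightarrow> real poly \<Rightarrow> nat \<Rightarrow> real" where
  "op_eigenvalue a b n = of_nat n * (of_nat n - 1) * coeff a 2 + of_nat n * coeff b 1"

lemma hypergeometric_op_linear:
  "hypergeometric_op a b (p + q) = hypergeometric_op a b p + hypergeometric_op a b q"
  "hypergeometric_op a b (smult c p) = smult c (hypergeometric_op a b p)"
  "hypergeometric_op a b (p - q) = hypergeometric_op a b p - hypergeometric_op a b q"
  "hypergeometric_op a b 0 = 0"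
  by (simp_all add: hypergeometric_op_def pderiv_add pderiv_smult pderiv_diff algebra_simps
      smult_add_right)

lemma quadratic_poly_cases:
  fixes a :: "'a::zero poly"
  assumes "degree a \<le> 2"
  obtains a0 a1 a2 where "a = [:a0, a1, a2:]"
proof -
  have "a = [:coeff a 0, coeff a 1, coeff a 2:]"
  proof (rule poly_eqI)
    fix n show "coeff a n = coeff [:coeff a 0, coeff a 1, coeff a 2:] n"
      using assms by (auto simp: coeff_pCons coeff_eq_0 eval_nat_numeral split: nat.splits)
  qed
  thus ?thesis by (rule that)
qed

lemma linear_poly_cases:
  fixes b :: "'a::zero poly"
  assumes "degree b \<le> 1"
  obtains b0 b1 where "b = [:b0, b1:]"
proof -
  have "b = [:coeff b 0, coeff b 1:]"
  proof (rule poly_eqI)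
    fix n show "coeff b n = coeff [:coeff b 0, coeff b 1:] n"
      using assms by (auto simp: coeff_pCons coeff_eq_0 eval_nat_numeral split: nat.splits)
  qed
  thus ?thesis by (rule that)
qed

lemma coeff_hypergeometric_op:
  "coeff (hypergeometric_op [:a0, a1, a2:] [:b0, b1:] p) n =
     of_real a0 * of_nat ((n + 2) * (n + 1)) * coeff p (n + 2)
   + (of_real a1 * of_nat n + of_real b0) * of_nat (n + 1) * coeff p (n + 1)
   + of_real (op_eigenvalue [:a0, a1, a2:] [:b0, b1:] n) * coeff p n"
proof -
  have mp: "map_poly complex_of_real [:a0, a1, a2:] = [:of_real a0, of_real a1, of_real a2:]"
           "map_poly complex_of_real [:b0, b1:] = [:of_real b0, of_real b1:]"
    by (simp_all add: map_poly_pCons)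
  consider "n = 0" | "n = 1" | k where "n = Suc (Suc k)"
    by (metis One_nat_def not0_implies_Suc)
  thus ?thesis
    by cases (simp_all add: hypergeometric_op_def op_eigenvalue_def mp mult_pCons_right
      coeff_pCons coeff_pderiv eval_nat_numeral algebra_simps)
qed

lemma hypergeometric_op_top:
  assumes "degree a \<le> 2" "degree b \<le> 1" "degree p \<le> n"
  shows "coeff (hypergeometric_op a b p) n = of_real (op_eigenvalue a b n) * coeff p n"
    and "degree (hypergeometric_op a b p) \<le> n"
proof -
  obtain a0 a1 a2 where a: "a = [:a0, a1, a2:]" using quadratic_poly_cases assms by blast
  obtain b0 b1 where b: "b = [:b0, b1:]" using linear_poly_cases assms by blast
  show "coeff (hypergeometric_op a b p) n = of_real (op_eigenvalue a b n) * coeff p n"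
    using assms unfolding a b coeff_hypergeometric_op by (simp add: coeff_eq_0)
  show "degree (hypergeometric_op a b p) \<le> n"
    using assms unfolding a b by (intro degree_le) (simp add: coeff_hypergeometric_op coeff_eq_0)
qed

lemma hypergeometric_eigenpoly_degree:
  assumes "degree a \<le> 2" "degree b \<le> 1" "inj (op_eigenvalue a b)"
    and "hypergeometric_op a b p = smult (of_real (op_eigenvalue a b n)) p" "p \<noteq> 0"
  shows "degree p = n"
proof -
  have "of_real (op_eigenvalue a b n) * lead_coeff p =
      of_real (op_eigenvalue a b (degree p)) * lead_coeff p"
    using hypergeometric_op_top(1)[OF assms(1,2), of p "degree p"] assms(4) by simp
  hence "op_eigenvalue a b n = op_eigenvalue a b (degree p)" using assms(5) by simp
  thus ?thesis using assms(3) by (auto simp: inj_def)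
qed

text \<open>The eigenvalue determines the degree, so \<open>q\<close> minus the multiple of \<open>p\<close> with the same
  \<open>n\<close>-th coefficient can only be 0.\<close>

lemma hypergeometric_eigenpoly_unique:
  assumes "degree a \<le> 2" "degree b \<le> 1" "inj (op_eigenvalue a b)"
    and p: "hypergeometric_op a b p = smult (of_real (op_eigenvalue a b n)) p"
      "degree p = n" "lead_coeff p = 1"
    and q: "hypergeometric_op a b q = smult (of_real (op_eigenvalue a b n)) q"
  shows "q = smult (coeff q n) p"
proof (rule ccontr)
  define d where "d = q - smult (coeff q n) p"
  assume "q \<noteq> smult (coeff q n) p"
  hence "d \<noteq> 0" by (simp add: d_def)
  moreover have "hypergeometric_op a b d = smult (of_real (op_eigenvalue a b n)) d"
    by (simp add: d_def hypergeometric_op_linear p(1) q smult_diff_right mult.commute)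
  ultimately have "degree d = n" by (rule hypergeometric_eigenpoly_degree[OF assms(1-3), rotated])
  moreover have "coeff d n = 0" using p(2,3) by (simp add: d_def)
  ultimately show False using \<open>d \<noteq> 0\<close> by auto
qed

text \<open>The operator is triangular in the monomial basis and its diagonal entries are distinct, so
  subtracting the \<open>n\<close>-th one leaves it invertible on the polynomials of degree below \<open>n\<close>. The
  bound \<open>k\<close> is what the back substitution runs over.\<close>

lemma hypergeometric_resolvent:
  assumes "degree a \<le> 2" "degree b \<le> 1" "inj (op_eigenvalue a b)"
  shows "k \<le> n \<Longrightarrow> r = 0 \<or> degree r < k \<Longrightarrow>
    \<exists>u. (u = 0 \<or> degree u < k) \<and>
        hypergeometric_op a b u - smult (of_real (op_eigenvalue a b n)) u = r"
proof (induction k arbitrary: r)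
  case 0
  thus ?case by (intro exI[of _ 0]) (auto simp: hypergeometric_op_linear)
next
  case (Suc k)
  let ?L = "\<lambda>u. hypergeometric_op a b u - smult (of_real (op_eigenvalue a b n)) u"
  \<comment> \<open>\<open>u0\<close> solves the equation up to terms of degree below \<open>k\<close>; the division is possible
    since the eigenvalues at \<open>k\<close> and \<open>n\<close> differ.\<close>
  define c where "c = complex_of_real (op_eigenvalue a b k) - of_real (op_eigenvalue a b n)"
  have c: "c \<noteq> 0" using injD[OF assms(3), of k n] Suc.prems(1) by (auto simp: c_def)
  define u0 where "u0 = monom (coeff r k / c) k"
  have du0: "degree u0 \<le> k" by (simp add: u0_def degree_monom_le)
  have dr: "degree r \<le> k" using Suc.prems(2) by auto
  define s where "s = r - ?L u0"
  have "degree s \<le> k" unfolding s_def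
    by (intro degree_diff_le dr hypergeometric_op_top(2)[OF assms(1,2)] du0
        order.trans[OF degree_smult_le])
  moreover have "coeff (?L u0) k = c * coeff u0 k"
    by (simp add: hypergeometric_op_top(1)[OF assms(1,2) du0] c_def algebra_simps)
  hence "coeff s k = 0" using c by (simp add: s_def u0_def)
  ultimately have "s = 0 \<or> degree s < k"
    by (metis leading_coeff_0_iff order_le_imp_less_or_eq)
  then obtain u where u: "u = 0 \<or> degree u < k" "?L u = s"
    using Suc.IH[of s] Suc.prems(1) by auto
  have "degree (u0 + u) < Suc k"
    using du0 u(1) by (auto intro: degree_add_less)
  moreover have "?L (u0 + u) = r"
    using u(2) by (simp add: s_def hypergeometric_op_linear smult_add_right algebra_simps)
  ultimately show ?case by blast
qed

text \<open>Start from \<open>x ^ n\<close>: the error has lower degree and is removed by the resolvent.\<close>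

lemma hypergeometric_eigenpoly_exists:
  assumes "degree a \<le> 2" "degree b \<le> 1" "inj (op_eigenvalue a b)"
  shows "\<exists>p. degree p = n \<and> lead_coeff p = 1 \<and>
           hypergeometric_op a b p = smult (of_real (op_eigenvalue a b n)) p"
proof -
  let ?L = "\<lambda>u. hypergeometric_op a b u - smult (of_real (op_eigenvalue a b n)) u"
  define m where "m = monom (1::complex) n"
  have dm: "degree m = n" "coeff m n = 1" by (simp_all add: m_def degree_monom_eq)
  define r where "r = - ?L m"
  have "degree r \<le> n" unfolding r_def degree_minus
    by (intro degree_diff_le hypergeometric_op_top(2)[OF assms(1,2)]
        order.trans[OF degree_smult_le]) (simp_all add: dm)
  moreover have "coeff r n = 0"
    using dm by (simp add: r_def hypergeometric_op_top(1)[OF assms(1,2)])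
  ultimately have "r = 0 \<or> degree r < n"
    by (metis leading_coeff_0_iff order_le_imp_less_or_eq)
  then obtain u where u: "u = 0 \<or> degree u < n" "?L u = r"
    using hypergeometric_resolvent[OF assms, of n n r] by auto
  have cu: "coeff u n = 0" using u(1) by (auto simp: coeff_eq_0)
  have "degree (m + u) \<le> n" using u(1) dm by (intro degree_add_le) auto
  moreover have "coeff (m + u) n = 1" using dm cu by simp
  ultimately have "degree (m + u) = n"
    by (metis le_antisym le_degree zero_neq_one)
  moreover have "?L (m + u) = 0"
    using u(2) by (simp add: r_def hypergeometric_op_linear smult_add_right algebra_simps)
  ultimately show ?thesis using \<open>coeff (m + u) n = 1\<close> by (intro exI[of _ "m + u"]) auto
qed

section \<open>Orthogonal polynomials of weights satisfying a Pearson equation\<close>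

lemma poly_map_poly_of_real: "poly (map_poly complex_of_real a) (of_real x) = of_real (poly a x)"
  by (induction a) (simp_all add: map_poly_pCons)

abbreviation cnj_poly :: "complex poly \<Rightarrow> complex poly" where
  "cnj_poly \<equiv> map_poly cnj"

lemma coeff_cnj_poly: "coeff (cnj_poly p) n = cnj (coeff p n)"
  by (simp add: coeff_map_poly)

lemma cnj_poly_simps:
  "cnj_poly (p + q) = cnj_poly p + cnj_poly q"
  "cnj_poly (smult c p) = smult (cnj c) (cnj_poly p)"
  "cnj_poly (p * q) = cnj_poly p * cnj_poly q"
  "cnj_poly (pderiv p) = pderiv (cnj_poly p)"
  "cnj_poly (map_poly complex_of_real a) = map_poly complex_of_real a"
  by (auto intro!: poly_eqI simp: coeff_cnj_poly coeff_mult coeff_pderiv coeff_map_poly)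

lemma hypergeometric_op_cnj_poly:
  "hypergeometric_op a b (cnj_poly p) = cnj_poly (hypergeometric_op a b p)"
  by (simp add: hypergeometric_op_def cnj_poly_simps)

text \<open>The inner product factors through this linear functional, which turns hermitian symmetry
  into an identity between polynomials.\<close>

definition weight_functional :: "scalar_weight \<Rightarrow> complex poly \<Rightarrow> complex" where
  "weight_functional w p =
     (LINT x:interval w|lborel. poly p (of_real x) * complex_of_real (density w x))"

lemma weight_inner_eq_functional: "weight_inner w p q = weight_functional w (p * cnj_poly q)"
  unfolding weight_inner_def weight_functional_def by (simp add: mult_ac)

text \<open>The condition \<open>pearson\<close> is the classical equation \<open>(a w)' = b w\<close> for the density \<open>w\<close>.
  Together with the vanishing of \<open>a w\<close> times every polynomial at the endpoints it is what
  integration by parts needs.\<close>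

locale classical_weight =
  fixes w :: scalar_weight and l u :: ereal and a b :: "real poly"
  assumes endpoints: "l < u" and interval_eq: "interval w = einterval l u"
    and degree_a: "degree a \<le> 2" and degree_b: "degree b \<le> 1"
    and inj_eigenvalue: "inj (op_eigenvalue a b)"
    and density_pos: "\<And>x. x \<in> interval w \<Longrightarrow> 0 < density w x"
    and pearson: "\<And>x. x \<in> interval w \<Longrightarrow> \<exists>d. (density w has_real_derivative d) (at x) \<and>
          poly a x * d + poly (pderiv a) x * density w x = poly b x * density w x"
    and moments: "\<And>k. set_integrable lborel (interval w) (\<lambda>x. x ^ k * density w x)"
    and boundary_lower:
      "\<And>k. (((\<lambda>x. x ^ k * (poly a x * density w x)) \<circ> real_of_ereal) \<longlongrightarrow> 0) (at_right l)"
    and boundary_upper: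
      "\<And>k. (((\<lambda>x. x ^ k * (poly a x * density w x)) \<circ> real_of_ereal) \<longlongrightarrow> 0) (at_left u)"

begin

lemma functional_integrable:
  "set_integrable lborel (interval w) (\<lambda>x. poly p (of_real x) * complex_of_real (density w x))"
proof -
  let ?I = "interval w"
  have eq: "(\<lambda>x. indicator ?I x *\<^sub>R (poly p (of_real x) * complex_of_real (density w x))) =
    (\<lambda>x. \<Sum>i\<le>degree p. coeff p i * of_real (indicator ?I x *\<^sub>R (x ^ i * density w x)))"
    by (rule ext) (simp add: poly_altdef sum_distrib_left sum_distrib_right scaleR_conv_of_real mult_ac)
  show ?thesis unfolding set_integrable_def eq
    by (intro Bochner_Integration.integrable_sum integrable_mult_right integrable_of_real
        moments[unfolded set_integrable_def])
qed

lemma functional_linear: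
  "weight_functional w (p + q) = weight_functional w p + weight_functional w q"
  "weight_functional w (smult c p) = c * weight_functional w p"
  "weight_functional w (p - q) = weight_functional w p - weight_functional w q"
  "weight_functional w 0 = 0"
  using functional_integrable[of p] functional_integrable[of q]
  by (simp_all add: weight_functional_def distrib_right left_diff_distrib mult.assoc)

lemma boundary_poly:
  assumes lim: "\<And>k. (((\<lambda>x. x ^ k * (poly a x * density w x)) \<circ> real_of_ereal) \<longlongrightarrow> 0) F"
  shows "(((\<lambda>x. poly (map_poly of_real a * r) (of_real x) * complex_of_real (density w x))
            \<circ> real_of_ereal) \<longlongrightarrow> 0) F"
proof -
  have eq: "(\<lambda>x. poly (map_poly of_real a * r) (of_real x) *
      complex_of_real (density w x)) \<circ> real_of_ereal =
     (\<lambda>y. \<Sum>i\<le>degree r. coeff r i *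
        of_real (((\<lambda>x. x ^ i * (poly a x * density w x)) \<circ> real_of_ereal) y))"
    by (rule ext) (simp add: poly_map_poly_of_real poly_altdef[of r]
        sum_distrib_left sum_distrib_right mult_ac)
  have "((\<lambda>y. \<Sum>i\<le>degree r. coeff r i *
        of_real (((\<lambda>x. x ^ i * (poly a x * density w x)) \<circ> real_of_ereal) y)) \<longlongrightarrow>
        (\<Sum>i\<le>degree r. coeff r i * of_real 0)) F"
    by (intro tendsto_intros lim)
  thus ?thesis unfolding eq by simp
qed

text \<open>The integrand is the derivative of \<open>a * r * density\<close>, which vanishes at both ends.\<close>

lemma functional_pearson:
  "weight_functional w (map_poly of_real a * pderiv r + map_poly of_real b * r) = 0"
proof -
  define A where "A = map_poly complex_of_real a"
  define B where "B = map_poly complex_of_real b"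
  define F where "F = (\<lambda>x::real. poly (A * r) (of_real x) * complex_of_real (density w x))"
  define f where "f = (\<lambda>x::real. poly (A * pderiv r + B * r) (of_real x) *
      complex_of_real (density w x))"
  have I: "x \<in> interval w \<longleftrightarrow> l < ereal x \<and> ereal x < u" for x
    by (simp add: interval_eq einterval_def)
  have dA: "pderiv A = map_poly complex_of_real (pderiv a)"
    by (rule poly_eqI) (simp add: A_def coeff_pderiv coeff_map_poly)
  have "(LBINT x=l..u. f x) = 0 - 0"
  proof (rule interval_integral_FTC_integrable[OF endpoints])
    fix x assume "l < ereal x" "ereal x < u"
    hence x: "x \<in> interval w" by (simp add: I)
    obtain d where d: "(density w has_real_derivative d) (at x)"
      "poly a x * d + poly (pderiv a) x * density w x = poly b x * density w x"
      using pearson[OF x] by blast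
    have "((\<lambda>x. poly (A * r) (complex_of_real x)) has_vector_derivative
             poly (pderiv (A * r)) (of_real x)) (at x)"
      by (intro has_vector_derivative_real_field poly_DERIV)
    moreover have "((\<lambda>x. complex_of_real (density w x)) has_vector_derivative of_real d) (at x)"
      using d(1) by (intro has_vector_derivative_of_real)
         (simp add: has_real_derivative_iff_has_vector_derivative)
    ultimately have "(F has_vector_derivative
        poly (A * r) (of_real x) * of_real d + poly (pderiv (A * r)) (of_real x) *
            of_real (density w x)) (at x)"
      unfolding F_def by (rule has_vector_derivative_mult)
    moreover have "poly (A * r) (of_real x) * of_real d + poly (pderiv (A * r)) (of_real x) *
        of_real (density w x) = f x"
    proof -
      have "complex_of_real (poly a x * d + poly (pderiv a) x * density w x) =
          of_real (poly b x * density w x)"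
        using d(2) by simp
      hence e: "poly A (of_real x) * of_real d =
          (poly B (of_real x) - poly (pderiv A) (of_real x)) * of_real (density w x)"
        unfolding dA unfolding A_def B_def poly_map_poly_of_real by (simp add: algebra_simps)
      have "poly (A * r) (of_real x) * of_real d =
          poly A (of_real x) * of_real d * poly r (of_real x)"
        by simp
      thus ?thesis unfolding e by (simp add: f_def pderiv_mult algebra_simps)
    qed
    ultimately show "(F has_vector_derivative f x) (at x)" by simp
    show "isCont f x" unfolding f_def using DERIV_isCont[OF d(1)]
      by (intro continuous_intros isCont_o2[OF _ poly_isCont]) auto
  next
    show "set_integrable lborel (einterval l u) f"
      unfolding f_def interval_eq[symmetric] by (rule functional_integrable)
    show "((F \<circ> real_of_ereal) \<longlongrightarrow> 0) (at_right l)" "((F \<circ> real_of_ereal) \<longlongrightarrow> 0) (at_left u)"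
      unfolding F_def A_def by (rule boundary_poly boundary_lower boundary_upper)+
  qed
  thus ?thesis using endpoints less_imp_le[OF endpoints]
    by (simp add: interval_lebesgue_integral_def weight_functional_def interval_eq f_def A_def B_def)
qed

lemma functional_op_symmetric:
  "weight_functional w (hypergeometric_op a b p * q) =
      weight_functional w (p * hypergeometric_op a b q)"
proof -
  \<comment> \<open>\<open>a * density * r\<close> is the boundary term of the double integration by parts.\<close>
  define r where "r = pderiv p * q - p * pderiv q"
  have "hypergeometric_op a b p * q - p * hypergeometric_op a b q =
        map_poly of_real a * pderiv r + map_poly of_real b * r"
    by (simp add: hypergeometric_op_def r_def pderiv_mult pderiv_diff algebra_simps)
  thus ?thesis using functional_pearson[of r]
    by (metis functional_linear(3) eq_iff_diff_eq_0)
qed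

lemma functional_definite:
  assumes "weight_functional w (p * cnj_poly p) = 0"
  shows "p = 0"
proof (rule ccontr)
  assume "p \<noteq> 0"
  let ?I = "interval w"
  \<comment> \<open>The integrand is a non-negative real function, so it vanishes almost everywhere; off the
    finitely many roots of \<open>p\<close> this would make the interval a null set.\<close>
  define g where "g = (\<lambda>x. indicator ?I x * ((cmod (poly p (of_real x)))\<^sup>2 * density w x))"
  have g: "complex_of_real (g x) =
     indicator ?I x *\<^sub>R (poly (p * cnj_poly p) (of_real x) * complex_of_real (density w x))" for x
    by (simp add: g_def complex_norm_square[symmetric] scaleR_conv_of_real
        del: of_real_power flip: of_real_mult)
  have "integrable lborel (\<lambda>x. complex_of_real (g x))"
    using functional_integrable[of "p * cnj_poly p"] unfolding set_integrable_def g[symmetric] .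
  hence int: "integrable lborel g" by (simp add: complex_of_real_integrable_eq)
  have "complex_of_real (integral\<^sup>L lborel g) = 0"
    using assms unfolding weight_functional_def set_lebesgue_integral_def g[symmetric] by simp
  moreover have nn: "AE x in lborel. 0 \<le> g x"
    by (intro AE_I2) (simp add: g_def density_pos less_imp_le split: split_indicator)
  ultimately have "AE x in lborel. g x = 0"
    using integral_nonneg_eq_0_iff_AE[OF int] by simp
  moreover have "AE x in lborel. x \<notin> {x::real. poly p (of_real x) = 0}"
  proof (rule AE_not_in, rule finite_imp_null_set_lborel)
    have "finite {z::complex. poly p z = 0}" using \<open>p \<noteq> 0\<close> by (rule poly_roots_finite)
    thus "finite {x::real. poly p (of_real x) = 0}"
      using finite_vimageI[of "{z. poly p z = 0}" complex_of_real] by (simp add: inj_def vimage_def)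
  qed
  ultimately have "AE x in lborel. x \<notin> ?I"
    by eventually_elim (use density_pos in \<open>fastforce simp: g_def\<close>)
  moreover have "open ?I" by (simp add: interval_eq)
  ultimately have "?I \<in> null_sets lborel"
    by (subst AE_iff_null_sets) auto
  hence "negligible ?I" by (simp add: negligible_iff_null_sets null_sets_completionI)
  moreover obtain c where "l < ereal c" "ereal c < u"
    using ereal_dense2[OF endpoints] by blast
  ultimately show False using open_not_negligible[OF \<open>open ?I\<close>] by
      (auto simp: interval_eq einterval_def)
qed

lemma monic_orthogonal_unique:
  assumes p: "is_monic_orthogonal w p" and q: "is_monic_orthogonal w q"
  shows "p = q"
proof
  fix n show "p n = q n"
  proof (induction n rule: less_induct)
    case (less n)
    have P: "degree (p j) = j" "lead_coeff (p j) = 1" for j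
      using p unfolding is_monic_orthogonal_def by blast+
    have P': "degree (q j) = j" "lead_coeff (q j) = 1" for j
      using q unfolding is_monic_orthogonal_def by blast+
    \<comment> \<open>The difference has lower degree and is orthogonal to the common earlier members, hence to
      itself.\<close>
    define d where "d = p n - q n"
    have "degree d \<le> n" unfolding d_def by (rule degree_diff_le) (simp_all add: P P')
    moreover have "coeff d n = 0" using P[of n] P'[of n] by (simp add: d_def)
    ultimately have d: "d = 0 \<or> degree d < n"
      by (metis leading_coeff_0_iff order_le_imp_less_or_eq)
    have "weight_functional w (d * cnj_poly d) = 0"
    proof (rule monic_basis_induct[where P = p and n = n and Q =
        "\<lambda>r. weight_functional w (d * cnj_poly r) = 0"])
      fix c j r assume j: "j < n" and r: "weight_functional w (d * cnj_poly r) = 0"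
      have "weight_inner w (p n) (p j) = 0" "weight_inner w (q n) (q j) = 0"
        using p q j by (auto simp: is_monic_orthogonal_def)
      hence "weight_functional w (d * cnj_poly (p j)) = 0"
        using less.IH[OF j]
        by (simp add: d_def weight_inner_eq_functional left_diff_distrib functional_linear)
      thus "weight_functional w (d * cnj_poly (r + smult c (p j))) = 0"
        using r by (simp add: cnj_poly_simps distrib_left functional_linear)
    qed (use P d in \<open>simp_all add: functional_linear\<close>)
    hence "d = 0" by (rule functional_definite)
    thus ?case by (simp add: d_def)
  qed
qed

text \<open>The operator is symmetric for the weight and its eigenvalues are distinct, so its monic
  eigenpolynomials are orthogonal; by uniqueness they are the monic orthogonal polynomials.\<close>

lemma monic_orthogonal_eigenpoly:
  "degree (monic_orthogonal w n) = n" "lead_coeff (monic_orthogonal w n) = 1"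
  "hypergeometric_op a b (monic_orthogonal w n) =
     smult (of_real (op_eigenvalue a b n)) (monic_orthogonal w n)"
proof -
  let ?e = "\<lambda>n. complex_of_real (op_eigenvalue a b n)"
  obtain P where P: "\<And>n. degree (P n) = n" "\<And>n. lead_coeff (P n) = 1"
    "\<And>n. hypergeometric_op a b (P n) = smult (?e n) (P n)"
    using hypergeometric_eigenpoly_exists[OF degree_a degree_b inj_eigenvalue] by metis
  have "weight_inner w (P m) (P n) = 0" if "m \<noteq> n" for m n
  proof -
    have "?e m * weight_functional w (P m * cnj_poly (P n)) =
          weight_functional w (hypergeometric_op a b (P m) * cnj_poly (P n))"
      by (simp add: P functional_linear)
    also have "\<dots> = weight_functional w (P m * hypergeometric_op a b (cnj_poly (P n)))"
      by (rule functional_op_symmetric)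
    also have "\<dots> = ?e n * weight_functional w (P m * cnj_poly (P n))"
      by (simp add: hypergeometric_op_cnj_poly P cnj_poly_simps functional_linear)
    finally show ?thesis
      using that inj_eigenvalue by (auto simp: weight_inner_eq_functional inj_def)
  qed
  hence "is_monic_orthogonal w P" using P by (simp add: is_monic_orthogonal_def)
  hence "monic_orthogonal w = P"
    unfolding monic_orthogonal_def using monic_orthogonal_unique by (intro the_equality) auto
  thus "degree (monic_orthogonal w n) = n" "lead_coeff (monic_orthogonal w n) = 1"
    "hypergeometric_op a b (monic_orthogonal w n) = smult (?e n) (monic_orthogonal w n)"
    using P by auto
qed

end

section \<open>Hermite, Laguerre and Jacobi weights\<close>

lemma classical_weight_hermite:
  "classical_weight (hermite_weight b) (-\<infinity>) \<infinity> 1 [:2 * b, -2:]"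
proof
  let ?d = "\<lambda>x::real. exp (- x\<^sup>2 + 2 * b * x)"
  have [simp]: "interval (hermite_weight b) = UNIV" "density (hermite_weight b) = ?d"
    by (simp_all add: hermite_weight_def)
  show "inj (op_eigenvalue 1 [:2 * b, -2:])"
    by (rule injI) (simp add: op_eigenvalue_def)
  show "\<exists>d. (density (hermite_weight b) has_real_derivative d) (at x) \<and>
      poly 1 x * d + poly (pderiv 1) x * density (hermite_weight b) x =
      poly [:2 * b, -2:] x * density (hermite_weight b) x" for x
    by (intro exI[of _ "?d x * (- 2 * x + 2 * b)"] conjI)
       (auto intro!: derivative_eq_intros simp: algebra_simps)
  show "set_integrable lborel (interval (hermite_weight b)) (\<lambda>x. x ^ k *
      density (hermite_weight b) x)" for k
  proof -
    \<comment> \<open>Up to a factor the weight is the normal density with mean \<open>b\<close> and variance 1/2, whose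
      central moments exist.\<close>
    define s where "s = 1 / sqrt (2::real)"
    have s: "s\<^sup>2 = 1/2" by (simp add: s_def power_divide)
    have nd: "?d x = exp (b\<^sup>2) * sqrt pi * normal_density b s x" for x
    proof -
      have "normal_density b s x = exp (- (x - b)\<^sup>2) / sqrt pi"
        by (simp add: normal_density_def s)
      moreover have "?d x = exp (b\<^sup>2) * exp (- (x - b)\<^sup>2)"
        unfolding exp_add[symmetric] by (simp add: power2_eq_square algebra_simps)
      ultimately show ?thesis by simp
    qed
    have eq: "x ^ k * ?d x = (\<Sum>i\<le>k. of_nat (k choose i) * b ^ (k - i) * (exp (b\<^sup>2) * sqrt pi) *
                 (normal_density b s x * (x - b) ^ i))" for x
    proof -
      have "x ^ k = ((x - b) + b) ^ k" by simp
      also have "\<dots> = (\<Sum>i\<le>k. of_nat (k choose i) * (x - b) ^ i * b ^ (k - i))"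
        by (rule binomial_ring)
      finally have "x ^ k * ?d x = (\<Sum>i\<le>k. of_nat (k choose i) * (x - b) ^ i * b ^ (k - i)) *
          (exp (b\<^sup>2) * sqrt pi * normal_density b s x)"
        by (simp only: nd)
      thus ?thesis unfolding sum_distrib_right by (simp only: mult_ac)
    qed
    have "integrable lborel (\<lambda>x. \<Sum>i\<le>k. of_nat (k choose i) * b ^ (k - i) * (exp (b\<^sup>2) * sqrt pi) *
                 (normal_density b s x * (x - b) ^ i))"
      by (intro Bochner_Integration.integrable_sum integrable_mult_right integrable_normal_moment)
         (simp add: s_def)
    hence "integrable lborel (\<lambda>x. x ^ k * ?d x)" by (simp only: eq)
    thus ?thesis by (simp add: set_integrable_def)
  qed
  show "(((\<lambda>x. x ^ k * (poly 1 x * density (hermite_weight b) x)) \<circ> real_of_ereal) \<longlongrightarrow>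
      0) (at_right (-\<infinity>))" for k
    unfolding ereal_tendsto_simps by simp real_asymp
  show "(((\<lambda>x. x ^ k * (poly 1 x * density (hermite_weight b) x)) \<circ> real_of_ereal) \<longlongrightarrow>
      0) (at_left \<infinity>)" for k
    unfolding ereal_tendsto_simps by simp real_asymp
qed (auto simp: hermite_weight_def einterval_def)

text \<open>The moments are Gamma integrals.\<close>

lemma classical_weight_laguerre:
  assumes "\<alpha> > -1"
  shows "classical_weight (laguerre_weight \<alpha>) 0 \<infinity> [:0, 1:] [:\<alpha> + 1, -1:]"
proof
  let ?w = "laguerre_weight \<alpha>"
  let ?d = "\<lambda>x::real. exp (- x) * x powr \<alpha>"
  have [simp]: "interval ?w = {0<..}" "density ?w = ?d"
    by (simp_all add: laguerre_weight_def)
  show "interval ?w = einterval 0 \<infinity>" by (auto simp: einterval_def)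
  show "inj (op_eigenvalue [:0, 1:] [:\<alpha> + 1, -1:])"
    by (rule injI) (simp add: op_eigenvalue_def numeral_2_eq_2)
  show "\<exists>d. (density ?w has_real_derivative d) (at x) \<and>
      poly [:0, 1:] x * d + poly (pderiv [:0, 1:]) x * density ?w x =
      poly [:\<alpha> + 1, -1:] x * density ?w x" if "x \<in> interval ?w" for x
    using that
    by (intro exI[of _ "exp (- x) * (\<alpha> * x powr (\<alpha> - 1)) - ?d x"] conjI)
       (auto intro!: derivative_eq_intros simp: algebra_simps powr_diff pderiv_pCons)
  show "set_integrable lborel (interval ?w) (\<lambda>x. x ^ k * density ?w x)" for k
  proof -
    have "((\<lambda>t. t powr ((k + \<alpha> + 1) - 1) / exp t) has_integral Gamma (k + \<alpha> + 1)) {0..}"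
      using assms by (intro Gamma_integral_real) linarith
    hence "((\<lambda>t. t powr ((k + \<alpha> + 1) - 1) / exp t) absolutely_integrable_on {0..})"
      by (intro nonnegative_absolutely_integrable_1) (auto simp: has_integral_iff)
    hence "set_integrable lebesgue {0<..} (\<lambda>t. t powr ((k + \<alpha> + 1) - 1) / exp t)"
      by (rule set_integrable_subset) auto
    hence "set_integrable lborel {0<..} (\<lambda>t. t powr ((k + \<alpha> + 1) - 1) / exp t)"
      unfolding set_integrable_def by (subst (asm) integrable_completion) auto
    moreover have "t powr ((k + \<alpha> + 1) - 1) / exp t = t ^ k * ?d t" if "t > 0" for t
      using that by (simp add: powr_add powr_realpow exp_minus field_simps)
    ultimately show ?thesis by (subst (asm) set_integrable_cong[OF refl refl]) auto
  qed
  have "((\<lambda>x::real. exp (- x) * x ^ k * x powr (\<alpha> + 1)) \<longlongrightarrow> exp (-0) * 0 ^ k * 0) (at_right 0)" for k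
    using assms by (intro tendsto_intros tendsto_zero_powrI) (auto simp: eventually_at_filter)
  moreover have "\<forall>\<^sub>F x in at_right 0. exp (- x) * x ^ k * x powr (\<alpha> + 1) =
      x ^ k * (poly [:0, 1:] x * density ?w x)" for k
    unfolding eventually_at_filter by (auto simp: powr_add)
  ultimately have "((\<lambda>x. x ^ k * (poly [:0, 1:] x * density ?w x)) \<longlongrightarrow>
      exp (-0) * 0 ^ k * 0) (at_right 0)" for k
    by (rule Lim_transform_eventually)
  hence "((\<lambda>x. x ^ k * (poly [:0, 1:] x * density ?w x)) \<longlongrightarrow> 0) (at_right 0)" for k
    by simp
  thus "(((\<lambda>x. x ^ k * (poly [:0, 1:] x * density ?w x)) \<circ> real_of_ereal) \<longlongrightarrow> 0) (at_right 0)" for k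
    unfolding zero_ereal_def ereal_tendsto_simps .
  show "(((\<lambda>x. x ^ k * (poly [:0, 1:] x * density ?w x)) \<circ> real_of_ereal) \<longlongrightarrow> 0) (at_left \<infinity>)" for k
    unfolding ereal_tendsto_simps by simp real_asymp
qed (auto simp: laguerre_weight_def)

lemma op_eigenvalue_jacobi:
  "op_eigenvalue [:1, 0, -1:] [:\<beta> - \<alpha>, -(\<alpha> + \<beta> + 2):] n = - of_nat n * (of_nat n + \<alpha> + \<beta> + 1)"
  by (simp add: op_eigenvalue_def numeral_2_eq_2 algebra_simps)

lemma classical_weight_jacobi:
  assumes "\<alpha> > -1" "\<beta> > -1"
  shows "classical_weight (jacobi_weight \<alpha> \<beta>) (ereal (-1)) (ereal 1) [:1, 0, -1:] [:\<beta> - \<alpha>, -(\<alpha> +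
      \<beta> + 2):]"
proof
  let ?w = "jacobi_weight \<alpha> \<beta>"
  let ?a = "[:1, 0, -1::real:]" and ?b = "[:\<beta> - \<alpha>, -(\<alpha> + \<beta> + 2):]"
  let ?d = "\<lambda>x::real. (1 - x) powr \<alpha> * (1 + x) powr \<beta>"
  have [simp]: "interval ?w = {-1<..<1}" "density ?w = ?d"
    by (simp_all add: jacobi_weight_def)
  show "interval ?w = einterval (ereal (-1)) (ereal 1)" by (auto simp: einterval_def)
  show "inj (op_eigenvalue ?a ?b)"
  proof (rule injI, rule ccontr)
    fix m n :: nat assume "op_eigenvalue ?a ?b m = op_eigenvalue ?a ?b n" "m \<noteq> n"
    hence "(real m - real n) * (real m + real n + \<alpha> + \<beta> + 1) = 0"
      unfolding op_eigenvalue_jacobi by (simp add: algebra_simps)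
    hence "real m + real n + \<alpha> + \<beta> + 1 = 0" using \<open>m \<noteq> n\<close> by simp
    moreover have "real m + real n \<ge> 1" using \<open>m \<noteq> n\<close> by linarith
    ultimately show False using assms by linarith
  qed
  show "\<exists>d. (density ?w has_real_derivative d) (at x) \<and>
      poly ?a x * d + poly (pderiv ?a) x * density ?w x = poly ?b x * density ?w x"
    if "x \<in> interval ?w" for x
  proof (intro exI conjI)
    have x: "1 - x > 0" "1 + x > 0" using that by auto
    show "(density ?w has_real_derivative
        (- \<alpha> * (1 - x) powr (\<alpha> - 1)) * (1 + x) powr \<beta> + (1 - x) powr \<alpha> * (\<beta> * (1 +
            x) powr (\<beta> - 1))) (at x)"
      using x by (auto intro!: derivative_eq_intros simp: algebra_simps)
    \<comment> \<open>Lowering both exponents by one turns the Pearson equation into a polynomial identity.\<close>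
    define y z where "y = (1 - x) powr (\<alpha> - 1)" and "z = (1 + x) powr (\<beta> - 1)"
    have yz: "(1 - x) powr \<alpha> = (1 - x) * y" "(1 + x) powr \<beta> = (1 + x) * z"
      using x by (simp_all add: y_def z_def powr_diff)
    show "poly ?a x * ((- \<alpha> * (1 - x) powr (\<alpha> - 1)) * (1 + x) powr \<beta> + (1 - x) powr \<alpha> * (\<beta> * (1 +
        x) powr (\<beta> - 1)))
       + poly (pderiv ?a) x * density ?w x = poly ?b x * density ?w x"
      by (simp add: yz pderiv_pCons flip: y_def z_def) (simp add: algebra_simps)
  qed
  show "set_integrable lborel (interval ?w) (\<lambda>x. x ^ k * density ?w x)" for k
  proof -
    \<comment> \<open>The Beta integrand, to be pulled back along \<open>x \<mapsto> (1 + x) / 2\<close>; it dominates because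
      \<open>\<bar>x\<bar> < 1\<close> on the interval.\<close>
    define h where "h = (\<lambda>t::real. indicator {0..1} t *\<^sub>R (t powr (\<beta> + 1 - 1) * (1 - t) powr (\<alpha> +
        1 - 1)))"
    have "integrable lborel h"
      unfolding h_def set_integrable_def[symmetric] by (rule integrable_Beta) (use assms in auto)
    hence "integrable lborel (\<lambda>x. h (1/2 + (1/2) * x))"
      by (rule lborel_integrable_real_affine) simp
    hence "integrable lborel (\<lambda>x. 2 powr (\<alpha> + \<beta>) * h (1/2 + (1/2) * x))" by simp
    hence "set_integrable lborel {-1<..<1} (\<lambda>x. x ^ k * ?d x)"
      unfolding set_integrable_def
    proof (rule Bochner_Integration.integrable_bound)
      show "AE x in lborel. norm (indicator {-1<..<1} x *\<^sub>R (x ^ k * ?d x))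
         \<le> norm (2 powr (\<alpha> + \<beta>) * h (1/2 + (1/2) * x))"
      proof (intro AE_I2)
        fix x :: real
        show "norm (indicator {-1<..<1} x *\<^sub>R (x ^ k * ?d x)) \<le>
            norm (2 powr (\<alpha> + \<beta>) * h (1/2 + (1/2) * x))"
        proof (cases "x \<in> {-1<..<1}")
          case True
          hence "\<bar>x\<bar> ^ k \<le> 1" by (intro power_le_one) auto
          hence "\<bar>x\<bar> ^ k * ?d x \<le> 1 * ?d x" by (intro mult_right_mono) auto
          moreover have "?d x = 2 powr (\<alpha> + \<beta>) * h (1/2 + (1/2) * x)"
          proof -
            define y where "y = 1/2 + (1/2) * x"
            have y: "y \<in> {0..1}" "y = (1 + x) / 2" "1 - y = (1 - x) / 2"
              using True by (auto simp: y_def field_simps)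
            have "h y = ((1 + x) / 2) powr \<beta> * ((1 - x) / 2) powr \<alpha>"
              unfolding y(2,3)[symmetric] using y(1) by (simp add: h_def)
            hence "?d x = 2 powr (\<alpha> + \<beta>) * h y"
              using True by (simp add: powr_divide powr_add)
            thus ?thesis by (simp only: y_def)
          qed
          moreover have "h (1/2 + (1/2) * x) \<ge> 0" by (simp add: h_def)
          ultimately show ?thesis using True by (simp add: abs_mult power_abs)
        qed simp
      qed
    qed measurable
    thus ?thesis by simp
  qed
  have lim: "((\<lambda>x. x ^ k * (poly ?a x * density ?w x)) \<longlongrightarrow> 0) F"
    if F: "((\<lambda>x. x) \<longlongrightarrow> s) F" "\<forall>\<^sub>F x in F. x \<in> {-1<..<1}" and s: "s = 1 \<or> s = -1"
        for k s and F :: "real filter"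
  proof -
    have "((\<lambda>x. x ^ k * ((1 - x) powr (\<alpha> + 1) * (1 + x) powr (\<beta> + 1))) \<longlongrightarrow>
          s ^ k * ((1 - s) powr (\<alpha> + 1) * (1 + s) powr (\<beta> + 1))) F"
      using assms
      by (intro tendsto_mult tendsto_powr' tendsto_power tendsto_diff tendsto_add tendsto_const F(1)
           disjI2 conjI eventually_mono[OF F(2)]) auto
    moreover have "\<forall>\<^sub>F x in F. x ^ k * ((1 - x) powr (\<alpha> + 1) * (1 + x) powr (\<beta> + 1)) =
         x ^ k * (poly ?a x * density ?w x)"
      by (rule eventually_mono[OF F(2)]) (simp add: powr_add algebra_simps)
    ultimately have "((\<lambda>x. x ^ k * (poly ?a x * density ?w x)) \<longlongrightarrow>
          s ^ k * ((1 - s) powr (\<alpha> + 1) * (1 + s) powr (\<beta> + 1))) F"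
      by (rule Lim_transform_eventually)
    thus ?thesis using s assms by auto
  qed
  show "(((\<lambda>x. x ^ k * (poly ?a x * density ?w x)) \<circ> real_of_ereal) \<longlongrightarrow> 0) (at_right (ereal (-1)))"
      for k
    unfolding ereal_tendsto_simps
    by (intro lim[of "-1"] tendsto_ident_at eventually_at_right_real) simp_all
  show "(((\<lambda>x. x ^ k * (poly ?a x * density ?w x)) \<circ> real_of_ereal) \<longlongrightarrow> 0) (at_left (ereal 1))" for k
    unfolding ereal_tendsto_simps
    by (intro lim[of 1] tendsto_ident_at eventually_at_left_real) simp_all
qed (auto simp: jacobi_weight_def)

section \<open>Intertwiners and Darboux transformations\<close>

text \<open>An operator that commutes maps eigenpolynomials to eigenpolynomials, and these are unique
  up to scaling.\<close>

lemma commuting_imp_intertwiner: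
  assumes w1: "classical_weight w1 l1 u1 a b1" and w2: "classical_weight w2 l2 u2 a b2"
    and e: "op_eigenvalue a b1 = op_eigenvalue a b2"
    and V: "V \<in> diffops"
    and comm: "\<And>p. V (hypergeometric_op a b1 p) = hypergeometric_op a b2 (V p)"
  shows "V \<in> intertwiners w1 w2"
proof -
  interpret w1: classical_weight w1 l1 u1 a b1 by (rule w1)
  interpret w2: classical_weight w2 l2 u2 a b2 by (rule w2)
  have "\<exists>A. V (monic_orthogonal w1 n) = smult A (monic_orthogonal w2 n)" for n
  proof -
    have "hypergeometric_op a b2 (V (monic_orthogonal w1 n)) =
          smult (of_real (op_eigenvalue a b2 n)) (V (monic_orthogonal w1 n))"
      by (simp flip: comm add: w1.monic_orthogonal_eigenpoly(3) diffops_linear[OF V] e)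
    from hypergeometric_eigenpoly_unique[OF w2.degree_a w2.degree_b w2.inj_eigenvalue
        w2.monic_orthogonal_eigenpoly(3,1,2) this]
    show ?thesis by blast
  qed
  thus ?thesis using V by (simp add: intertwiners_def)
qed

text \<open>Both composites are linear and agree on the basis of orthogonal polynomials.\<close>

lemma intertwiner_imp_commuting:
  assumes w1: "classical_weight w1 l1 u1 a b1" and w2: "classical_weight w2 l2 u2 a b2"
    and e: "op_eigenvalue a b1 = op_eigenvalue a b2"
    and T: "T \<in> intertwiners w1 w2"
  shows "T (hypergeometric_op a b1 p) = hypergeometric_op a b2 (T p)"
proof -
  interpret w1: classical_weight w1 l1 u1 a b1 by (rule w1)
  interpret w2: classical_weight w2 l2 u2 a b2 by (rule w2)
  have T': "T \<in> diffops" using T by (simp add: intertwiners_def)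
  note lin = diffops_linear[OF T'] hypergeometric_op_linear
  have "(\<lambda>p. T (hypergeometric_op a b1 p)) = (\<lambda>p. hypergeometric_op a b2 (T p))"
  proof (rule linear_eq_on_monic_basis[where P = "monic_orthogonal w1"])
    fix n
    obtain A where A: "T (monic_orthogonal w1 n) = smult A (monic_orthogonal w2 n)"
      using T unfolding intertwiners_def by blast
    show "T (hypergeometric_op a b1 (monic_orthogonal w1 n)) =
        hypergeometric_op a b2 (T (monic_orthogonal w1 n))"
      by (simp add: w1.monic_orthogonal_eigenpoly w2.monic_orthogonal_eigenpoly A lin e mult.commute)
  qed (use w1.monic_orthogonal_eigenpoly in \<open>simp_all add: lin\<close>)
  thus ?thesis by meson
qed

text \<open>The intertwiner is the second factor \<open>N\<close>.\<close>

lemma Darboux_imp_intertwiner: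
  assumes w1: "classical_weight w1 l1 u1 a1 b1" and w2: "classical_weight w2 l2 u2 a2 b2"
    and D: "w1 is_Darboux_transformation_of w2"
  shows "intertwiners w1 w2 \<noteq> {\<lambda>p. 0}"
proof -
  interpret w2: classical_weight w2 l2 u2 a2 b2 by (rule w2)
  obtain V N where VN: "V \<in> diffops" "N \<in> diffops" "degree_preserving V" "degree_preserving N"
    "V \<cdot>\<^sub>\<Omega> N \<in> intertwiners w2 w2" "V \<in> intertwiners w2 w1"
    using D unfolding darboux_transformation_def intertwiners_def by blast
  have "\<exists>\<Lambda>. N (monic_orthogonal w1 n) = smult \<Lambda> (monic_orthogonal w2 n)" for n
  proof -
    obtain A where A: "V (monic_orthogonal w2 n) = smult A (monic_orthogonal w1 n)"
      using VN(6) unfolding intertwiners_def by blast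
    obtain B where B: "N (V (monic_orthogonal w2 n)) = smult B (monic_orthogonal w2 n)"
      using VN(5) unfolding intertwiners_def by auto
    \<comment> \<open>As \<open>V\<close> preserves degrees, \<open>A\<close> is nonzero and can be divided out of
      \<open>N (V p) = B p\<close>.\<close>
    have "monic_orthogonal w2 n \<noteq> 0" using w2.monic_orthogonal_eigenpoly(2)[of n] by auto
    hence "V (monic_orthogonal w2 n) \<noteq> 0" using VN(3) by (simp add: degree_preserving_def)
    hence "A \<noteq> 0" using A by auto
    moreover have "smult A (N (monic_orthogonal w1 n)) = smult B (monic_orthogonal w2 n)"
      using B by (simp add: A diffops_linear[OF VN(2)])
    hence "smult (1 / A) (smult A (N (monic_orthogonal w1 n))) =
        smult (1 / A) (smult B (monic_orthogonal w2 n))"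
      by simp
    ultimately show ?thesis by auto
  qed
  hence "N \<in> intertwiners w1 w2" using VN(2) by (simp add: intertwiners_def)
  moreover have "N 1 \<noteq> 0" using VN(4) by (simp add: degree_preserving_def)
  hence "N \<noteq> (\<lambda>p. 0)" by auto
  ultimately show ?thesis by auto
qed

text \<open>Unlike the Darboux relation, this is visibly an equivalence relation, so it can be built
  up along a chain of parameters.\<close>

definition mutually_intertwined :: "scalar_weight \<Rightarrow> scalar_weight \<Rightarrow> bool" where
  "mutually_intertwined w w' \<longleftrightarrow>
     (\<exists>V \<in> intertwiners w w'. \<exists>N \<in> intertwiners w' w.
        degree_preserving V \<and> degree_preserving N)"

lemma mutually_intertwined_refl: "mutually_intertwined w w"
proof -
  have id: "id = diffop 1" by (auto simp: fun_eq_iff diffop_def)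
  hence "id \<in> diffops" by (auto simp: diffops_def)
  moreover from this have "id \<in> intertwiners w w"
    by (auto simp: intertwiners_def intro: exI[of _ 1])
  moreover have "degree_preserving id" by (simp add: degree_preserving_def)
  ultimately show ?thesis unfolding mutually_intertwined_def by blast
qed

lemma mutually_intertwined_sym: "mutually_intertwined w w' \<Longrightarrow> mutually_intertwined w' w"
  unfolding mutually_intertwined_def by blast

lemma intertwiners_comp:
  assumes "T \<in> intertwiners w1 w2" "S \<in> intertwiners w2 w3"
  shows "T \<cdot>\<^sub>\<Omega> S \<in> intertwiners w1 w3"
proof -
  have T: "T \<in> diffops" and S: "S \<in> diffops" using assms by (auto simp: intertwiners_def)
  have "\<exists>\<Lambda>. (T \<cdot>\<^sub>\<Omega> S) (monic_orthogonal w1 n) = smult \<Lambda> (monic_orthogonal w3 n)" for n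
  proof -
    obtain A where "T (monic_orthogonal w1 n) = smult A (monic_orthogonal w2 n)"
      using assms(1) by (auto simp: intertwiners_def)
    moreover obtain B where "S (monic_orthogonal w2 n) = smult B (monic_orthogonal w3 n)"
      using assms(2) unfolding intertwiners_def by blast
    ultimately show ?thesis
      by (intro exI[of _ "A * B"]) (simp add: diffops_linear[OF S])
  qed
  thus ?thesis using diffops_comp[OF T S] by (simp add: intertwiners_def)
qed

lemma degree_preserving_comp:
  "degree_preserving V \<Longrightarrow> degree_preserving N \<Longrightarrow> degree_preserving (V \<cdot>\<^sub>\<Omega> N)"
  by (simp add: degree_preserving_def)

lemma mutually_intertwined_trans:
  "mutually_intertwined w1 w2 \<Longrightarrow> mutually_intertwined w2 w3 \<Longrightarrow> mutually_intertwined w1 w3"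
  unfolding mutually_intertwined_def by (meson intertwiners_comp degree_preserving_comp)

lemma mutually_intertwined_imp_Darboux:
  assumes "mutually_intertwined w w'" "interval w' = interval w"
  shows "w' is_Darboux_transformation_of w"
proof -
  obtain V N where VN: "degree_preserving V" "degree_preserving N"
    "V \<in> intertwiners w w'" "N \<in> intertwiners w' w"
    using assms(1) unfolding mutually_intertwined_def by blast
  have diffops: "V \<in> diffops" "N \<in> diffops" using VN(3,4) by (simp_all add: intertwiners_def)
  have "V \<cdot>\<^sub>\<Omega> N \<in> intertwiners w w" using VN(3,4) by (rule intertwiners_comp)
  moreover have "\<forall>n. \<exists>A. V (monic_orthogonal w n) = smult A (monic_orthogonal w' n)"
    using VN(3) by (simp add: intertwiners_def)
  ultimately show ?thesis unfolding darboux_transformation_def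
      using VN(1,2) diffops assms(2) by blast
qed

section \<open>Ladder operators\<close>

definition first_order_op :: "complex poly \<Rightarrow> complex \<Rightarrow> complex poly \<Rightarrow> complex poly" where
  "first_order_op g c p = pderiv p * g + smult c p"

lemma first_order_op_diffops: "first_order_op g c \<in> diffops"
proof -
  have "first_order_op g c p = diffop [:[:c:], g:] p" for p
    by (subst diffop_eq_sum[of _ 1]) (simp_all add: first_order_op_def)
  hence "first_order_op g c = diffop [:[:c:], g:]" by (simp add: fun_eq_iff)
  thus ?thesis by (auto simp: diffops_def)
qed

text \<open>The condition says that no top coefficient is annihilated.\<close>

lemma degree_preserving_first_order_op:
  assumes "degree g \<le> 1" and nz: "\<And>n. of_nat n * coeff g 1 + c \<noteq> 0"
  shows "degree_preserving (first_order_op g c)"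
  unfolding degree_preserving_def
proof (intro allI impI)
  fix p :: "complex poly" assume p: "p \<noteq> 0"
  obtain g0 g1 where g: "g = [:g0, g1:]" using linear_poly_cases assms(1) by blast
  have co: "coeff (first_order_op g c p) n =
      g0 * of_nat (n + 1) * coeff p (n + 1) + (of_nat n * g1 + c) * coeff p n" for n
    by (cases n) (simp_all add: g first_order_op_def coeff_pderiv algebra_simps)
  have "coeff (first_order_op g c p) (degree p) = (of_nat (degree p) * g1 + c) * lead_coeff p"
    unfolding co by (simp add: coeff_eq_0)
  hence nz': "coeff (first_order_op g c p) (degree p) \<noteq> 0" using nz[of "degree p"] p by
      (simp add: g)
  moreover have "degree (first_order_op g c p) \<le> degree p"
    by (rule degree_le) (simp add: co coeff_eq_0)
  ultimately show "first_order_op g c p \<noteq> 0 \<and> degree (first_order_op g c p) = degree p"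
    by (auto intro: le_antisym le_degree)
qed

lemma mutually_intertwined_first_order:
  assumes w1: "classical_weight w1 l1 u1 a b1" and w2: "classical_weight w2 l2 u2 a b2"
    and e: "op_eigenvalue a b1 = op_eigenvalue a b2"
    and V: "degree g \<le> 1" "\<And>n. of_nat n * coeff g 1 + c \<noteq> 0"
      "\<And>p. first_order_op g c (hypergeometric_op a b1 p) =
          hypergeometric_op a b2 (first_order_op g c p)"
    and N: "degree h \<le> 1" "\<And>n. of_nat n * coeff h 1 + d \<noteq> 0"
      "\<And>p. first_order_op h d (hypergeometric_op a b2 p) =
          hypergeometric_op a b1 (first_order_op h d p)"
  shows "mutually_intertwined w1 w2"
  unfolding mutually_intertwined_def
  using commuting_imp_intertwiner[OF w1 w2 e first_order_op_diffops V(3)]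
    commuting_imp_intertwiner[OF w2 w1 e[symmetric] first_order_op_diffops N(3)]
    degree_preserving_first_order_op[OF V(1,2)] degree_preserving_first_order_op[OF N(1,2)] by blast

text \<open>Both identities express contiguity of Laguerre polynomials, \<open>L\<^sub>n\<close> for \<open>\<alpha> + 1\<close> being the
  image of \<open>L\<^sub>n\<close> for \<open>\<alpha>\<close> under \<open>1 - \<partial>\<close>.\<close>

lemma laguerre_ladder:
  fixes \<alpha> :: real
  defines "op1 \<equiv> hypergeometric_op [:0, 1:] [:\<alpha> + 1, -1:]"
    and "op2 \<equiv> hypergeometric_op [:0, 1:] [:\<alpha> + 1 + 1, -1:]"
  shows "first_order_op [:-1:] 1 (op1 p) = op2 (first_order_op [:-1:] 1 p)"
    and "first_order_op [:0, 1:] (of_real (\<alpha> + 1)) (op2 p) =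
         op1 (first_order_op [:0, 1:] (of_real (\<alpha> + 1)) p)"
  unfolding op1_def op2_def first_order_op_def hypergeometric_op_def 
    poly_eq_poly_eq_iff[symmetric] fun_eq_iff
  by (simp_all add: map_poly_pCons pderiv_add pderiv_mult pderiv_pCons
      pderiv_smult pderiv_diff pderiv_minus algebra_simps)

lemma laguerre_step:
  assumes "\<alpha> > -1"
  shows "mutually_intertwined (laguerre_weight \<alpha>) (laguerre_weight (\<alpha> + 1))"
proof (rule mutually_intertwined_first_order[OF classical_weight_laguerre classical_weight_laguerre _ _ _
      laguerre_ladder(1) _ _ laguerre_ladder(2)])
  show "of_nat n * coeff [:0, 1:] 1 + complex_of_real (\<alpha> + 1) \<noteq> 0" for n
  proof -
    have "complex_of_real (real n + (\<alpha> + 1)) \<noteq> 0" using assms unfolding of_real_eq_0_iff by simp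
    thus ?thesis by simp
  qed
qed (use assms in \<open>simp_all add: op_eigenvalue_def fun_eq_iff\<close>)

lemma laguerre_steps:
  assumes "\<alpha> > -1"
  shows "mutually_intertwined (laguerre_weight \<alpha>) (laguerre_weight (\<alpha> + of_nat k))"
proof (induction k)
  case (Suc k)
  have "mutually_intertwined (laguerre_weight (\<alpha> + of_nat k)) (laguerre_weight (\<alpha> + of_nat k + 1))"
    by (rule laguerre_step) (use assms in linarith)
  with Suc show ?case by (auto intro: mutually_intertwined_trans simp: add_ac)
qed (simp add: mutually_intertwined_refl)

lemma laguerre_integer_difference:
  assumes "\<alpha>1 > -1" "\<alpha>2 > -1" "\<alpha>1 - \<alpha>2 \<in> \<int>"
  shows "mutually_intertwined (laguerre_weight \<alpha>2) (laguerre_weight \<alpha>1)"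
proof -
  obtain z where z: "\<alpha>1 - \<alpha>2 = of_int z" using assms(3) by (rule Ints_cases)
  show ?thesis
  proof (cases "z \<ge> 0")
    case True
    hence "\<alpha>1 = \<alpha>2 + of_nat (nat z)" using z by simp
    thus ?thesis using laguerre_steps[OF assms(2), of "nat z"] by simp
  next
    case False
    hence "\<alpha>2 = \<alpha>1 + of_nat (nat (- z))" using z by simp
    thus ?thesis using mutually_intertwined_sym[OF laguerre_steps[OF assms(1), of
        "nat (- z)"]] by simp
  qed
qed

text \<open>These ladder operators keep \<open>\<alpha> + \<beta>\<close> and therefore the eigenvalues.\<close>

lemma jacobi_ladder:
  fixes \<alpha> \<beta> :: real
  defines "op1 \<equiv> hypergeometric_op [:1, 0, -1:] [:\<beta> - \<alpha>, -(\<alpha> + \<beta> + 2):]"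
    and "op2 \<equiv> hypergeometric_op [:1, 0, -1:] [:(\<beta> - 1) - (\<alpha> + 1), -((\<alpha> + 1) + (\<beta> - 1) + 2):]"
  shows "first_order_op [:1, 1:] (of_real \<beta>) (op1 p) = op2 (first_order_op [:1, 1:] (of_real \<beta>) p)"
    and "first_order_op [:1, -1:] (- of_real (\<alpha> + 1)) (op2 p) =
         op1 (first_order_op [:1, -1:] (- of_real (\<alpha> + 1)) p)"
  unfolding op1_def op2_def first_order_op_def hypergeometric_op_def 
    poly_eq_poly_eq_iff[symmetric] fun_eq_iff
  by (simp_all add: map_poly_pCons pderiv_add pderiv_mult pderiv_pCons
      pderiv_smult pderiv_diff pderiv_minus algebra_simps)

text \<open>Positivity of \<open>\<beta>\<close> does two things: the target parameter \<open>\<beta> - 1\<close> is admissible, and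
  \<open>(1 + x) \<partial> + \<beta>\<close> does not annihilate constants.\<close>

lemma jacobi_step:
  assumes "\<alpha> > -1" "\<beta> > 0"
  shows "mutually_intertwined (jacobi_weight \<alpha> \<beta>) (jacobi_weight (\<alpha> + 1) (\<beta> - 1))"
proof (rule mutually_intertwined_first_order[OF classical_weight_jacobi classical_weight_jacobi _ _ _
      jacobi_ladder(1) _ _ jacobi_ladder(2)])
  show "of_nat n * coeff [:1, 1:] 1 + complex_of_real \<beta> \<noteq> 0" for n
  proof -
    have "complex_of_real (real n + \<beta>) \<noteq> 0" using assms unfolding of_real_eq_0_iff by simp
    thus ?thesis by simp
  qed
  show "of_nat n * coeff [:1, -1:] 1 + - complex_of_real (\<alpha> + 1) \<noteq> 0" for n
  proof -
    have "complex_of_real (- real n - (\<alpha> + 1)) \<noteq> 0" using assms unfolding of_real_eq_0_iff by simp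
    moreover have "of_nat n * coeff [:1, -1:] 1 + - complex_of_real (\<alpha> + 1) =
        complex_of_real (- real n - (\<alpha> + 1))" by simp
    ultimately show ?thesis by (simp only: not_False_eq_True)
  qed
qed (use assms in \<open>simp_all add: op_eigenvalue_def fun_eq_iff numeral_2_eq_2\<close>)

lemma jacobi_steps:
  assumes "\<alpha> > -1" "\<beta> - of_nat k > -1"
  shows "mutually_intertwined (jacobi_weight \<alpha> \<beta>) (jacobi_weight (\<alpha> + of_nat k) (\<beta> - of_nat k))"
  using assms(2)
proof (induction k)
  case (Suc k)
  have "mutually_intertwined (jacobi_weight (\<alpha> + of_nat k) (\<beta> - of_nat k))
          (jacobi_weight (\<alpha> + of_nat k + 1) (\<beta> - of_nat k - 1))"
    by (rule jacobi_step) (use assms(1) Suc.prems in \<open>simp_all add: algebra_simps\<close>)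
  moreover have "mutually_intertwined (jacobi_weight \<alpha> \<beta>) (jacobi_weight (\<alpha> +
      of_nat k) (\<beta> - of_nat k))"
    using Suc by simp
  ultimately show ?case
    by (auto dest: mutually_intertwined_trans simp: algebra_simps)
qed (simp add: mutually_intertwined_refl)

lemma jacobi_integer_difference:
  assumes "\<alpha>1 > -1" "\<beta>1 > -1" "\<alpha>2 > -1" "\<beta>2 > -1" "\<alpha>1 + \<beta>1 = \<alpha>2 + \<beta>2" "\<alpha>1 - \<alpha>2 \<in> \<int>"
  shows "mutually_intertwined (jacobi_weight \<alpha>2 \<beta>2) (jacobi_weight \<alpha>1 \<beta>1)"
proof -
  obtain z where z: "\<alpha>1 - \<alpha>2 = of_int z" using assms(6) by (rule Ints_cases)
  show ?thesis
  proof (cases "z \<ge> 0")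
    case True
    hence "\<alpha>1 = \<alpha>2 + of_nat (nat z)" "\<beta>1 = \<beta>2 - of_nat (nat z)" using z assms(5) by simp_all
    thus ?thesis using jacobi_steps[OF assms(3), of \<beta>2 "nat z"] assms(2) by simp
  next
    case False
    hence "\<alpha>2 = \<alpha>1 + of_nat (nat (- z))" "\<beta>2 = \<beta>1 - of_nat (nat (- z))" using z assms(5) by simp_all
    thus ?thesis
      using mutually_intertwined_sym[OF jacobi_steps[OF assms(1), of \<beta>1
          "nat (- z)"]] assms(4) by simp
  qed
qed

section \<open>The leading coefficient of an intertwiner\<close>

lemma higher_pderiv_mult_X:
  "(pderiv ^^ j) (p * [:0, 1:]) =
     (pderiv ^^ j) p * [:0, 1:] + of_nat j * (pderiv ^^ (j - 1)) (p :: complex poly)"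
proof (induction j)
  case (Suc j)
  have "(pderiv ^^ Suc j) (p * [:0, 1:]) =
      pderiv ((pderiv ^^ j) p * [:0, 1:] + of_nat j * (pderiv ^^ (j - 1)) p)"
    by (simp only: funpow.simps o_apply Suc)
  also have "\<dots> = (pderiv ^^ Suc j) p * [:0, 1:] + of_nat (Suc j) * (pderiv ^^ j) p"
    by (cases j) (simp_all add: pderiv_add pderiv_mult pderiv_pCons algebra_simps
        del: mult_pCons_right mult_pCons_left)
  finally show ?case by simp
qed simp

text \<open>The coefficient sequence of an operator preceded by multiplication with \<open>x\<close>: in the \<open>j\<close>-th
  derivative of \<open>x p\<close> the term \<open>j p^(j-1)\<close> of the Leibniz rule amounts to differentiating the
  coefficient sequence as a polynomial in \<open>\<partial>\<close>.\<close>

definition precompose_X :: "complex poly poly \<Rightarrow> complex poly poly" where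
  "precompose_X f = smult [:0, 1:] f + pderiv f"

lemma diffop_mult_X: "diffop f (p * [:0, 1:]) = diffop (precompose_X f) p"
proof -
  define N where "N = degree f"
  have "diffop f (p * [:0, 1:]) =
    (\<Sum>j\<le>N. (pderiv ^^ j) p * [:0, 1:] * coeff f j) + (\<Sum>j\<le>N. of_nat j * (pderiv ^^ (j - 1)) p *
        coeff f j)"
    by (simp add: diffop_def N_def higher_pderiv_mult_X distrib_right sum.distrib
        del: mult_pCons_right mult_pCons_left)
  also have "(\<Sum>j\<le>N. (pderiv ^^ j) p * [:0, 1:] * coeff f j) = diffop (smult [:0, 1:] f) p"
    by (simp only: diffop_smult) (simp add: diffop_def N_def sum_distrib_left sum_distrib_right mult_ac
        del: mult_pCons_right mult_pCons_left)
  also have "(\<Sum>j\<le>N. of_nat j * (pderiv ^^ (j - 1)) p * coeff f j) =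
             (\<Sum>j\<le>Suc N. of_nat j * (pderiv ^^ (j - 1)) p * coeff f j)"
    by (simp add: N_def coeff_eq_0)
  also have "\<dots> = (\<Sum>j\<le>N. (pderiv ^^ j) p * coeff (pderiv f) j)"
    by (subst sum.atMost_Suc_shift) (simp add: coeff_pderiv mult_ac of_nat_poly)
  also have "\<dots> = diffop (pderiv f) p"
    by (rule diffop_eq_sum[symmetric]) (simp add: N_def degree_pderiv)
  finally show ?thesis by (simp add: precompose_X_def diffop_add)
qed

lemma diffop_pderiv: "diffop f (pderiv p) = diffop (pCons 0 f) p"
proof -
  have "diffop (pCons 0 f) p = (\<Sum>j\<le>Suc (degree f). (pderiv ^^ j) p * coeff (pCons 0 f) j)"
    by (rule diffop_eq_sum) (simp add: degree_pCons_le)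
  also have "\<dots> = diffop f (pderiv p)"
    by (subst sum.atMost_Suc_shift) (simp add: diffop_def funpow_swap1)
  finally show ?thesis ..
qed

lemma coeff_precompose_X:
  "coeff (precompose_X f) j = [:0, 1:] * coeff f j + of_nat (Suc j) * coeff f (Suc j)"
  by (simp only: precompose_X_def coeff_add coeff_smult coeff_pderiv)

lemma diffop_linear: "diffop f (p + q) = diffop f p + diffop f q"
  "diffop f (smult c p) = diffop (smult [:c:] f) p"
proof -
  have "diffop f \<in> diffops" by (auto simp: diffops_def)
  note l = diffops_linear[OF this]
  show "diffop f (p + q) = diffop f p + diffop f q" by (rule l)
  show "diffop f (smult c p) = diffop (smult [:c:] f) p" by (simp add: l diffop_smult)
qed

text \<open>With \<open>m\<close> the order of the commuting operator, the coefficients of order \<open>m + 2\<close> agree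
  identically, so the first condition comes from order \<open>m + 1\<close>. There, differentiating \<open>p'' a\<close>
  \<open>m\<close> times yields \<open>m a' g\<close>, differentiating \<open>p^(m) g\<close> twice yields \<open>2 a g'\<close>, and the
  contributions of the coefficient below \<open>g\<close> cancel.\<close>

lemma leading_symbol_equation:
  assumes comm: "\<And>p. diffop f (hypergeometric_op a b1 p) = hypergeometric_op a b2 (diffop f p)"
    and "degree a \<le> 2" "degree b1 \<le> 1"
  defines "g \<equiv> lead_coeff f"
  shows "of_nat (degree f) * map_poly of_real (pderiv a) * g
           + (map_poly of_real b1 - map_poly of_real b2) * g
         = 2 * map_poly of_real a * pderiv g"
proof -
  obtain a0 a1 a2 where a: "a = [:a0, a1, a2:]" using quadratic_poly_cases assms by blast
  obtain c0 c1 where b: "b1 = [:c0, c1:]" using linear_poly_cases assms by blast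
  define m where "m = degree f"
  define A where "A = map_poly complex_of_real a"
  define B1 where "B1 = map_poly complex_of_real b1"
  define B2 where "B2 = map_poly complex_of_real b2"
  define X :: "complex poly" where "X = [:0, 1:]"
  have A: "A = [:of_real a0, of_real a1, of_real a2:]" by (simp add: A_def a map_poly_pCons)
  have B1: "B1 = [:of_real c0, of_real c1:]" by (simp add: B1_def b map_poly_pCons)
  \<comment> \<open>\<open>h1\<close> and \<open>h2\<close> are the coefficient sequences of the two composites.\<close>
  define h1 where "h1 = pCons 0 (pCons 0 (smult [:of_real a0:] f + precompose_X (smult
      [:of_real a1:] f)
       + precompose_X (precompose_X (smult [:of_real a2:] f))))
     + pCons 0 (smult [:of_real c0:] f + precompose_X (smult [:of_real c1:] f))"
  have h1: "diffop f (hypergeometric_op a b1 p) = diffop h1 p" for p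
  proof -
    have q: "q * A = smult (of_real a0) q + smult (of_real a1) (q * X) + smult (of_real a2) (q *
        X * X)" for q
      by (simp add: A X_def algebra_simps)
    have r: "q * B1 = smult (of_real c0) q + smult (of_real c1) (q * X)" for q
      by (simp add: B1 X_def algebra_simps)
    show ?thesis
      unfolding hypergeometric_op_def A_def[symmetric] B1_def[symmetric] q r h1_def
      by (simp only: diffop_linear diffop_mult_X X_def diffop_add diffop_pderiv[symmetric])
  qed
  define D where "D = (\<lambda>f :: complex poly poly. pCons 0 f + map_poly pderiv f)"
  define h2 where "h2 = smult A (D (D f)) + smult B2 (D f)"
  have h2: "hypergeometric_op a b2 (diffop f p) = diffop h2 p" for p
  proof -
    have D: "pderiv (diffop u p) = diffop (D u) p" for u by (simp only: pderiv_diffop D_def)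
    show ?thesis
      by (simp only: hypergeometric_op_def D h2_def diffop_add diffop_smult A_def B2_def)
  qed
  have "diffop h1 = diffop h2" using comm h1 h2 by (simp add: fun_eq_iff)
  hence "h1 = h2" using inj_diffop by (auto simp: inj_def)
  hence eq: "coeff h1 (Suc m) = coeff h2 (Suc m)" by simp
  have z: "coeff f j = 0" if "j > m" for j using that by (simp add: m_def coeff_eq_0)
  have g: "coeff f m = g" by (simp add: g_def m_def)
  \<comment> \<open>\<open>e\<close> is the coefficient of order \<open>m - 1\<close>, read as 0 for an operator of order 0;
    it enters both sides as \<open>A * e\<close> and cancels.\<close>
  define e where "e = (case m of 0 \<Rightarrow> 0 | Suc k \<Rightarrow> coeff f k)"
  have l: "coeff h1 (Suc m) = A * e + of_nat m * pderiv A * g + B1 * g"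
  proof (cases m)
    case 0
    thus ?thesis using g z
      by (simp add: h1_def e_def coeff_precompose_X B1 A)
  next
    case (Suc k)
    have gk: "coeff f (Suc k) = g" using g Suc by simp
    have zk: "coeff f (Suc (Suc k)) = 0" "coeff f (Suc (Suc (Suc k))) = 0" using z Suc by auto
    show ?thesis unfolding Suc
      by (simp add: h1_def e_def coeff_precompose_X B1 A Suc gk zk pderiv_pCons algebra_simps)
         (simp add: poly_eq_poly_eq_iff[symmetric] fun_eq_iff algebra_simps)
  qed
  have Df: "coeff (D f) m = e + pderiv g" "coeff (D f) (Suc m) = g"
    using g z by (simp_all add: D_def coeff_map_poly e_def coeff_pCons)
  have "coeff (D (D f)) (Suc m) = coeff (D f) m + pderiv (coeff (D f) (Suc m))"
    by (simp add: D_def coeff_map_poly)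
  hence r: "coeff h2 (Suc m) = A * (e + 2 * pderiv g) + B2 * g"
    by (simp add: h2_def Df algebra_simps)
  have "map_poly complex_of_real (pderiv a) = pderiv A"
    by (simp add: A a pderiv_pCons map_poly_pCons)
  with l r eq show ?thesis
    unfolding A_def[symmetric] B1_def[symmetric] B2_def[symmetric] m_def[symmetric]
    by (simp add: algebra_simps)
qed

text \<open>The symbol equation constrains the parameters through the mere existence of a nonzero
  polynomial solution, so the intertwiner itself can be forgotten.\<close>

lemma intertwiner_symbol:
  assumes w1: "classical_weight w1 l1 u1 a b1" and w2: "classical_weight w2 l2 u2 a b2"
    and e: "op_eigenvalue a b1 = op_eigenvalue a b2"
    and T: "T \<in> intertwiners w1 w2" "T \<noteq> (\<lambda>p. 0)"
  obtains m g where "g \<noteq> 0"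
    "of_nat m * map_poly of_real (pderiv a) * g + (map_poly of_real b1 - map_poly of_real b2) * g
       = 2 * map_poly complex_of_real a * pderiv g"
proof -
  obtain f where f: "T = diffop f" using T by (auto simp: intertwiners_def diffops_def)
  have "f \<noteq> 0" using T(2) by (auto simp: f)
  moreover have "degree a \<le> 2" "degree b1 \<le> 1" using w1 by (auto simp: classical_weight_def)
  ultimately show ?thesis
    using leading_symbol_equation[of f a b1 b2] intertwiner_imp_commuting[OF w1 w2 e T(1)]
    by (intro that[of "lead_coeff f" "degree f"]) (auto simp: f)
qed

section \<open>Jacobi polynomials at the right endpoint\<close>

abbreviation jacobi_op :: "real \<Rightarrow> real \<Rightarrow> complex poly \<Rightarrow> complex poly" where
  "jacobi_op \<alpha> \<beta> \<equiv> hypergeometric_op [:1, 0, -1:] [:\<beta> - \<alpha>, -(\<alpha> + \<beta> + 2):]"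

lemma higher_pderiv_jacobi_op:
  "(pderiv ^^ k) (jacobi_op \<alpha> \<beta> p) =
     (pderiv ^^ (k + 2)) p * [:1, 0, -1:]
     + (pderiv ^^ (k + 1)) p * [:of_real (\<beta> - \<alpha>), - of_real (\<alpha> + \<beta> + 2 + 2 * real k):]
     - smult (of_real (real k * (real k + \<alpha> + \<beta> + 1))) ((pderiv ^^ k) p)"
proof (induction k)
  case 0
  show ?case by (simp add: hypergeometric_op_def map_poly_pCons)
next
  case (Suc k)
  show ?case
    unfolding funpow.simps(2) o_apply Suc poly_eq_poly_eq_iff[symmetric] fun_eq_iff
    by (simp add: pderiv_add pderiv_mult pderiv_pCons
      pderiv_smult pderiv_diff pderiv_minus algebra_simps)
qed

text \<open>At 1 the coefficient of the second derivative vanishes, so the \<open>k\<close>-fold differentiated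
  equation is a two-term recursion for the derivatives there. The factor \<open>2 (k + \<alpha> + 1)\<close> in
  front of the next derivative is nonzero as \<open>\<alpha> > -1\<close>.\<close>

lemma jacobi_op_eigen_derivatives_at_1:
  assumes "\<alpha> > -1"
  shows "\<exists>R. \<forall>e p. jacobi_op \<alpha> \<beta> p = smult e p \<longrightarrow>
           poly ((pderiv ^^ k) p) 1 = poly R e * poly p 1"
proof (induction k)
  case 0
  show ?case by (intro exI[of _ 1]) auto
next
  case (Suc k)
  then obtain R where R: "\<And>e p. jacobi_op \<alpha> \<beta> p = smult e p \<Longrightarrow>
           poly ((pderiv ^^ k) p) 1 = poly R e * poly p 1" by blast
  define c where "c = complex_of_real (2 * (real k + \<alpha> + 1))"
  define d where "d = complex_of_real (real k * (real k + \<alpha> + \<beta> + 1))"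
  have c: "c \<noteq> 0" using assms unfolding c_def of_real_eq_0_iff by simp
  have "poly ((pderiv ^^ Suc k) p) 1 = poly (smult (- 1 / c) ([:d, 1:] * R)) e * poly p 1"
    if e: "jacobi_op \<alpha> \<beta> p = smult e p" for e p
  proof -
    have "poly ((pderiv ^^ k) (jacobi_op \<alpha> \<beta> p)) 1 =
          - c * poly ((pderiv ^^ Suc k) p) 1 - d * poly ((pderiv ^^ k) p) 1"
      unfolding higher_pderiv_jacobi_op by (simp add: c_def d_def algebra_simps)
    hence "e * (poly R e * poly p 1) = - c * poly ((pderiv ^^ Suc k) p) 1 - d * (poly R e *
        poly p 1)"
      unfolding e higher_pderiv_smult poly_smult R[OF e] .
    hence "poly ((pderiv ^^ Suc k) p) 1 * c = - (e + d) * (poly R e * poly p 1)"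
      by algebra
    hence "poly ((pderiv ^^ Suc k) p) 1 = - (e + d) * (poly R e * poly p 1) / c"
      using c by (rule eq_divide_imp[rotated])
    moreover have "poly (smult (- 1 / c) ([:d, 1:] * R)) e = - (e + d) * poly R e / c"
      by (simp add: divide_inverse algebra_simps)
    ultimately show ?thesis by simp
  qed
  thus ?case by blast
qed

lemma jacobi_op_eigen_nonzero_at_1:
  assumes "\<alpha> > -1" "jacobi_op \<alpha> \<beta> p = smult e p" "p \<noteq> 0"
  shows "poly p 1 \<noteq> 0"
proof
  assume z: "poly p 1 = 0"
  \<comment> \<open>The top derivative is a nonzero constant, yet a multiple of \<open>poly p 1\<close>.\<close>
  let ?q = "(pderiv ^^ degree p) p"
  have "poly ?q 1 = 0"
    using jacobi_op_eigen_derivatives_at_1[OF assms(1), of \<beta> "degree p"] assms(2) z by auto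
  moreover have "degree ?q = 0" by (simp add: degree_higher_pderiv)
  then obtain c where c: "?q = [:c:]" by (rule degree_eq_zeroE)
  ultimately have "?q = 0" by simp
  moreover have "coeff ?q 0 = pochhammer 1 (degree p) * lead_coeff p"
    by (simp add: coeff_higher_pderiv)
  ultimately show False using assms(3) by (simp flip: pochhammer_fact)
qed

text \<open>The value at 1 is a fixed combination of the derivatives there, so the factor \<open>M\<close> depends
  on the operator but not on the eigenpolynomial.\<close>

lemma diffop_jacobi_eigen_at_1:
  assumes "\<alpha> > -1" "T \<in> diffops"
  shows "\<exists>M. \<forall>e p. jacobi_op \<alpha> \<beta> p = smult e p \<longrightarrow> poly (T p) 1 = poly M e * poly p 1"
proof -
  obtain f where f: "T = diffop f" using assms(2) by (auto simp: diffops_def)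
  obtain R where R: "\<And>k e p. jacobi_op \<alpha> \<beta> p = smult e p \<Longrightarrow>
           poly ((pderiv ^^ k) p) 1 = poly (R k) e * poly p 1"
    using jacobi_op_eigen_derivatives_at_1[OF assms(1), of \<beta>] by metis
  show ?thesis
    by (intro exI[of _ "\<Sum>j\<le>degree f. smult (poly (coeff f j) 1) (R j)"])
       (auto simp: f diffop_def poly_sum R sum_distrib_left mult_ac)
qed

text \<open>A polynomial in a quadratic expression has even degree, and the extra factor \<open>n\<close> makes it
  odd.\<close>

lemma quadratic_parity:
  fixes M K :: "complex poly"
  assumes eq: "\<And>n::nat. of_nat n * poly M (- of_nat n * (of_nat n + s)) =
      poly K (- of_nat n * (of_nat n + s))"
  shows "M = 0"
proof (rule ccontr)
  assume "M \<noteq> 0"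
  define g where "g = [:0, -s, -1::complex:]"
  have g: "degree g = 2" by (simp add: g_def)
  have gn: "poly g (of_nat n) = - of_nat n * (of_nat n + s)" for n
    by (simp add: g_def algebra_simps)
  \<comment> \<open>The identity holds at all natural numbers, hence between polynomials in \<open>n\<close>.\<close>
  have "[:0, 1:] * pcompose M g = pcompose K g"
  proof (rule ccontr)
    let ?d = "[:0, 1:] * pcompose M g - pcompose K g"
    assume "[:0, 1:] * pcompose M g \<noteq> pcompose K g"
    hence "finite {x. poly ?d x = 0}" by (intro poly_roots_finite) simp
    moreover have "range of_nat \<subseteq> {x. poly ?d x = 0}"
      using eq by (auto simp: poly_pcompose gn)
    ultimately have "finite (range (of_nat :: nat \<Rightarrow> complex))" by (rule rev_finite_subset)
    thus False using range_inj_infinite[OF inj_of_nat] by blast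
  qed
  hence "degree ([:0, 1:] * pcompose M g) = degree K * 2" by (simp add: degree_pcompose g)
  moreover have "pcompose M g \<noteq> 0" using \<open>M \<noteq> 0\<close> g by (simp add: pcompose_eq_0_iff)
  hence "degree ([:0, 1:] * pcompose M g) = Suc (degree M * 2)"
    by (subst degree_mult_eq) (simp_all add: degree_pcompose g)
  ultimately show False by presburger
qed

text \<open>Value and slope at 1 of the images of the orthogonal polynomials are compared. If the sums
  differed, the eigenvalue shift would produce an odd power of \<open>n\<close>.\<close>

lemma jacobi_intertwiner_parameter_sum:
  assumes par: "\<alpha>1 > -1" "\<alpha>2 > -1"
    and w1: "classical_weight w1 l u [:1, 0, -1:] [:\<beta>1 - \<alpha>1, -(\<alpha>1 + \<beta>1 + 2):]"
    and w2: "classical_weight w2 l u [:1, 0, -1:] [:\<beta>2 - \<alpha>2, -(\<alpha>2 + \<beta>2 + 2):]"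
    and T: "T \<in> intertwiners w1 w2" "T \<noteq> (\<lambda>p. 0)"
  shows "\<alpha>1 + \<beta>1 = \<alpha>2 + \<beta>2"
proof (rule ccontr)
  assume ne: "\<alpha>1 + \<beta>1 \<noteq> \<alpha>2 + \<beta>2"
  interpret w1: classical_weight w1 l u "[:1, 0, -1:]" "[:\<beta>1 - \<alpha>1, -(\<alpha>1 + \<beta>1 + 2):]" by (rule w1)
  interpret w2: classical_weight w2 l u "[:1, 0, -1:]" "[:\<beta>2 - \<alpha>2, -(\<alpha>2 + \<beta>2 + 2):]" by (rule w2)
  define p where "p = monic_orthogonal w1"
  define q where "q = monic_orthogonal w2"
  define e1 where "e1 n = - of_nat n * (of_nat n + complex_of_real (\<alpha>1 + \<beta>1 + 1))" for n
  define e2 where "e2 n = - of_nat n * (of_nat n + complex_of_real (\<alpha>2 + \<beta>2 + 1))" for n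
  define c where "c = complex_of_real (2 * (\<alpha>2 + 1))"
  define s where "s = complex_of_real (\<alpha>2 + \<beta>2 - (\<alpha>1 + \<beta>1))"
  have c: "c \<noteq> 0" using par unfolding c_def of_real_eq_0_iff by simp
  have p: "jacobi_op \<alpha>1 \<beta>1 (p n) = smult (e1 n) (p n)" "p n \<noteq> 0" for n
    using w1.monic_orthogonal_eigenpoly(2,3)[of n]
    by (auto simp: p_def e1_def op_eigenvalue_def numeral_2_eq_2 algebra_simps)
  have q: "jacobi_op \<alpha>2 \<beta>2 (q n) = smult (e2 n) (q n)" "q n \<noteq> 0" for n
    using w2.monic_orthogonal_eigenpoly(2,3)[of n]
    by (auto simp: q_def e2_def op_eigenvalue_def numeral_2_eq_2 algebra_simps)
  note p1 = jacobi_op_eigen_nonzero_at_1[OF par(1) p]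
  note q1 = jacobi_op_eigen_nonzero_at_1[OF par(2) q]
  have T': "T \<in> diffops" using T by (simp add: intertwiners_def)
  obtain L where L: "\<And>n. T (p n) = smult (L n) (q n)"
    using T(1) unfolding intertwiners_def p_def q_def by (auto; metis)
  obtain M where M: "\<And>n. poly (T (p n)) 1 = poly M (e1 n) * poly (p n) 1"
    using diffop_jacobi_eigen_at_1[OF par(1) T'] p by metis
  obtain K where K: "\<And>n. poly (pderiv (T (p n))) 1 = poly K (e1 n) * poly (p n) 1"
    using diffop_jacobi_eigen_at_1[OF par(1) diffops_funpow_pderiv[OF T', of 1]] p by (auto; metis)
  \<comment> \<open>The differential equation at 1, where its leading coefficient vanishes.\<close>
  have dq: "c * poly (pderiv (q n)) 1 = - e2 n * poly (q n) 1" for n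
  proof -
    have "- (2 * poly (pderiv (q n)) 1) =
        e2 n * poly (q n) 1 + of_real \<alpha>2 * (2 * poly (pderiv (q n)) 1)"
      using arg_cong[OF q(1)[of n], of "\<lambda>r. poly r 1"]
      by (simp add: hypergeometric_op_def map_poly_pCons algebra_simps)
    moreover have "c = 2 * (of_real \<alpha>2 + 1)" by (simp add: c_def)
    ultimately show ?thesis by algebra
  qed
  \<comment> \<open>Comparing value and slope of \<open>T (p n)\<close> at 1 eliminates \<open>L n\<close>; the shift \<open>s * n\<close> between
    the eigenvalues is the only term that is not a polynomial in \<open>e1 n\<close>.\<close>
  have "of_nat n * poly (smult s M) (e1 n) = poly ([:0, 1:] * M + smult c K) (e1 n)" for n
  proof -
    have "c * poly K (e1 n) * poly (p n) 1 = - e2 n * poly M (e1 n) * poly (p n) 1"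
    proof -
      have "L n * poly (pderiv (q n)) 1 = poly K (e1 n) * poly (p n) 1"
        "L n * poly (q n) 1 = poly M (e1 n) * poly (p n) 1"
        using K[of n] M[of n] by (simp_all add: L pderiv_smult)
      thus ?thesis using dq[of n] by algebra
    qed
    hence "c * poly K (e1 n) = - e2 n * poly M (e1 n)" using p1[of n] by (metis mult_right_cancel)
    moreover have "e2 n = e1 n - s * of_nat n" by (simp add: e1_def e2_def s_def algebra_simps)
    ultimately show ?thesis by (simp add: algebra_simps)
  qed
  hence "smult s M = 0" unfolding e1_def by (rule quadratic_parity)
  hence "M = 0" using ne unfolding s_def smult_eq_0_iff of_real_eq_0_iff by simp
  hence "T (p n) = 0" for n using M[of n] q1[of n] by (simp add: L)
  hence "T = (\<lambda>p. 0)"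
    using w1.monic_orthogonal_eigenpoly diffops_linear[OF T']
    by (intro linear_eq_on_monic_basis[where P = p]) (auto simp: p_def)
  with T(2) show False ..
qed

section \<open>Parameters of intertwined weights\<close>

text \<open>With \<open>a = 1\<close> the symbol equation makes \<open>g'\<close> a constant multiple of \<open>g\<close>, and a nonzero
  polynomial satisfies this only for the constant 0.\<close>

lemma hermite_intertwiner:
  assumes T: "T \<in> intertwiners (hermite_weight b1) (hermite_weight b2)" "T \<noteq> (\<lambda>p. 0)"
  shows "b1 = b2"
proof (rule ccontr)
  assume ne: "b1 \<noteq> b2"
  have "op_eigenvalue 1 [:2 * b1, -2:] = op_eigenvalue 1 [:2 * b2, -2:]"
    by (simp add: op_eigenvalue_def fun_eq_iff)
  from intertwiner_symbol[OF classical_weight_hermite classical_weight_hermite this T]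
  obtain m g where g: "g \<noteq> 0" and eq:
    "of_nat m * map_poly of_real (pderiv 1) * g +
       (map_poly of_real [:2 * b1, -2:] - map_poly of_real [:2 * b2, -2:]) * g
     = 2 * map_poly complex_of_real 1 * pderiv g" by metis
  have "smult (complex_of_real (2 * b1 - 2 * b2)) g = 2 * pderiv g"
    using eq by (simp add: map_poly_pCons)
  hence "coeff (smult (complex_of_real (2 * b1 - 2 * b2)) g) (degree g) =
      coeff (2 * pderiv g) (degree g)"
    by simp
  also have "\<dots> = 0" by (simp add: numeral_poly coeff_pderiv coeff_eq_0)
  finally have "complex_of_real (2 * b1 - 2 * b2) = 0" using g by simp
  thus False using ne unfolding of_real_eq_0_iff by simp
qed

lemma laguerre_intertwiner:
  assumes par: "\<alpha>1 > -1" "\<alpha>2 > -1"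
    and T: "T \<in> intertwiners (laguerre_weight \<alpha>1) (laguerre_weight \<alpha>2)" "T \<noteq> (\<lambda>p. 0)"
  shows "\<alpha>1 - \<alpha>2 \<in> \<int>"
proof -
  have "op_eigenvalue [:0, 1:] [:\<alpha>1 + 1, -1:] = op_eigenvalue [:0, 1:] [:\<alpha>2 + 1, -1:]"
    by (simp add: op_eigenvalue_def fun_eq_iff)
  from intertwiner_symbol[OF classical_weight_laguerre[OF par(1)]
      classical_weight_laguerre[OF par(2)] this T]
  obtain m g where g: "g \<noteq> 0" and eq:
    "of_nat m * map_poly of_real (pderiv [:0, 1:]) * g +
       (map_poly of_real [:\<alpha>1 + 1, -1:] - map_poly of_real [:\<alpha>2 + 1, -1:]) * g
     = 2 * map_poly complex_of_real [:0, 1:] * pderiv g" by metis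
  have "smult (of_nat m + of_real (\<alpha>1 - \<alpha>2)) g = smult 2 (pCons 0 (pderiv g))"
    using eq by (simp add: map_poly_pCons pderiv_pCons of_nat_poly numeral_poly
        smult_add_left smult_diff_left algebra_simps)
  \<comment> \<open>The top coefficient: \<open>x * g'\<close> multiplies it by the degree of \<open>g\<close>.\<close>
  hence "coeff (smult (of_nat m + of_real (\<alpha>1 - \<alpha>2)) g) (degree g) =
      coeff (smult 2 (pCons 0 (pderiv g))) (degree g)"
    by simp
  also have "\<dots> = 2 * of_nat (degree g) * lead_coeff g"
    by (simp add: coeff_pCons coeff_pderiv split: nat.splits)
  finally have "complex_of_real (of_nat m + (\<alpha>1 - \<alpha>2)) = of_real (2 * of_nat (degree g))"
      using g by simp
  hence "of_nat m + (\<alpha>1 - \<alpha>2) = 2 * of_nat (degree g)" unfolding of_real_eq_iff .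
  hence "\<alpha>1 - \<alpha>2 = of_int (2 * int (degree g) - int m)" by simp
  thus ?thesis by (metis Ints_of_int)
qed

lemma jacobi_intertwiner:
  assumes par: "\<alpha>1 > -1" "\<beta>1 > -1" "\<alpha>2 > -1" "\<beta>2 > -1"
    and T: "T \<in> intertwiners (jacobi_weight \<alpha>1 \<beta>1) (jacobi_weight \<alpha>2 \<beta>2)" "T \<noteq> (\<lambda>p. 0)"
  shows "\<alpha>1 + \<beta>1 = \<alpha>2 + \<beta>2" "\<alpha>1 - \<alpha>2 \<in> \<int>"
proof -
  note w1 = classical_weight_jacobi[OF par(1,2)] and w2 = classical_weight_jacobi[OF par(3,4)]
  show sum: "\<alpha>1 + \<beta>1 = \<alpha>2 + \<beta>2"
    by (rule jacobi_intertwiner_parameter_sum[OF par(1,3) w1 w2 T])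
  have "op_eigenvalue [:1, 0, -1:] [:\<beta>1 - \<alpha>1, -(\<alpha>1 + \<beta>1 + 2):] =
      op_eigenvalue [:1, 0, -1:] [:\<beta>2 - \<alpha>2, -(\<alpha>2 + \<beta>2 + 2):]"
    by (simp add: op_eigenvalue_def fun_eq_iff sum)
  from intertwiner_symbol[OF w1 w2 this T]
  obtain m g where g: "g \<noteq> 0" and eq:
    "of_nat m * map_poly of_real (pderiv [:1, 0, -1:]) * g +
       (map_poly of_real [:\<beta>1 - \<alpha>1, -(\<alpha>1 + \<beta>1 + 2):] - map_poly of_real [:\<beta>2 - \<alpha>2, -(\<alpha>2 + \<beta>2 +
           2):]) * g
     = 2 * map_poly complex_of_real [:1, 0, -1:] * pderiv g" by metis
  \<comment> \<open>Since \<open>1 - x\<^sup>2\<close> has a simple zero at 1, comparing the terms of lowest order there determines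
    the order \<open>k\<close> of the zero of \<open>g\<close>.\<close>
  define k where "k = order 1 g"
  obtain h where h: "g = [:-1, 1:] ^ k * h" "\<not> [:-1, 1:] dvd h"
    using order_decomp[OF g, of 1] by (auto simp: k_def)
  have h1: "poly h 1 \<noteq> 0" using h(2) by (simp add: poly_eq_0_iff_dvd)
  define X where "X = [:-1, 1::complex:]"
  have dg: "X * pderiv g = of_nat k * (X ^ k * h) + X ^ k * (X * pderiv h)"
  proof (cases k)
    case (Suc j)
    have "pderiv (X ^ k) = of_nat k * X ^ j"
      unfolding Suc pderiv_power_Suc by (simp add: X_def pderiv_pCons of_nat_poly)
    thus ?thesis unfolding h(1) X_def[symmetric] pderiv_mult
      by (simp only:) (simp add: Suc algebra_simps)
  qed (simp add: h(1))
  have d: "\<beta>1 - \<alpha>1 - (\<beta>2 - \<alpha>2) = -2 * (\<alpha>1 - \<alpha>2)" using sum by simp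
  have "X ^ k * ((of_nat m * [:0, -2:] + [:of_real (-2 * (\<alpha>1 - \<alpha>2)):]) * h) =
        X ^ k * (-2 * [:1, 1:] * (of_nat k * h + X * pderiv h))"
  proof -
    have "(of_nat m * [:0, -2:] + [:of_real (-2 * (\<alpha>1 - \<alpha>2)):]) * g =
        -2 * [:1, 1:] * (X * pderiv g)"
    proof -
      have "map_poly complex_of_real [:\<beta>1 - \<alpha>1, -(\<alpha>1 + \<beta>1 + 2):] - map_poly of_real
          [:\<beta>2 - \<alpha>2, -(\<alpha>2 + \<beta>2 + 2):]
            = [:of_real (-2 * (\<alpha>1 - \<alpha>2)):]"
        unfolding d[symmetric] by (simp add: map_poly_pCons sum)
      moreover have "map_poly complex_of_real (pderiv [:1, 0, -1:]) = [:0, -2:]"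
        by (simp add: pderiv_pCons map_poly_pCons)
      moreover have "2 * map_poly complex_of_real [:1, 0, -1:] = -2 * [:1, 1:] * X"
        by (simp add: map_poly_pCons X_def)
      ultimately show ?thesis using eq by (simp only: distrib_right mult.assoc)
    qed
    thus ?thesis unfolding dg unfolding h(1) X_def[symmetric] by (simp add: algebra_simps)
  qed
  moreover have "X ^ k \<noteq> 0" by (simp add: X_def)
  ultimately have "(of_nat m * [:0, -2:] + [:of_real (-2 * (\<alpha>1 - \<alpha>2)):]) * h =
      -2 * [:1, 1:] * (of_nat k * h + X * pderiv h)"
    by (simp only: mult_cancel_left simp_thms)
  from arg_cong[OF this, of "\<lambda>r. poly r 1"]
  have "(of_nat m * -2 + of_real (-2 * (\<alpha>1 - \<alpha>2))) * poly h 1 = (-4 * of_nat k) * poly h 1"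
    by (simp add: X_def algebra_simps)
  hence "complex_of_real (real m * -2 + (-2 * (\<alpha>1 - \<alpha>2))) = of_real (-4 * real k)"
    using h1 unfolding mult_right_cancel[OF h1] by simp
  hence "real m * -2 + (-2 * (\<alpha>1 - \<alpha>2)) = -4 * real k" unfolding of_real_eq_iff .
  hence "\<alpha>1 - \<alpha>2 = of_int (2 * int k - int m)" by simp
  thus "\<alpha>1 - \<alpha>2 \<in> \<int>" by (metis Ints_of_int)
qed

lemma zero_intertwiner: "(\<lambda>p. 0) \<in> intertwiners w1 w2"
  by (auto simp: intertwiners_def diffops_def intro: image_eqI[of _ _ 0] exI[of _ 0])

lemma nonzero_intertwiner_obtains:
  assumes "intertwiners w1 w2 \<noteq> {\<lambda>p. 0}"
  obtains T where "T \<in> intertwiners w1 w2" "T \<noteq> (\<lambda>p. 0)"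
  using assms zero_intertwiner[of w1 w2] by blast

theorem theorem6p3:
  fixes w1 w2 :: scalar_weight
  assumes "(w1 \<in> hermite_weights \<and> w2 \<in> hermite_weights) \<or>
           (w1 \<in> laguerre_weights \<and> w2 \<in> laguerre_weights) \<or>
           (w1 \<in> jacobi_weights \<and> w2 \<in> jacobi_weights)"
  shows "w1 is_Darboux_transformation_of w2 \<longleftrightarrow> intertwiners w1 w2 \<noteq> {\<lambda>p. 0}"
proof -
  consider (hermite) b1 b2 where "w1 = hermite_weight b1" "w2 = hermite_weight b2"
    | (laguerre) \<alpha>1 \<alpha>2 where "w1 = laguerre_weight \<alpha>1" "w2 = laguerre_weight \<alpha>2" "\<alpha>1 > -1" "\<alpha>2 > -1"
    | (jacobi) \<alpha>1 \<beta>1 \<alpha>2 \<beta>2 where "w1 = jacobi_weight \<alpha>1 \<beta>1" "w2 = jacobi_weight \<alpha>2 \<beta>2"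
        "\<alpha>1 > -1" "\<beta>1 > -1" "\<alpha>2 > -1" "\<beta>2 > -1"
    using assms unfolding hermite_weights_def laguerre_weights_def jacobi_weights_def by blast
  thus ?thesis
  proof cases
    case hermite
    have "mutually_intertwined w2 w1" if "intertwiners w1 w2 \<noteq> {\<lambda>p. 0}"
      using nonzero_intertwiner_obtains[OF that] hermite_intertwiner mutually_intertwined_refl hermite
      by metis
    moreover have "interval w1 = interval w2" by (simp add: hermite hermite_weight_def)
    ultimately show ?thesis
      using Darboux_imp_intertwiner classical_weight_hermite mutually_intertwined_imp_Darboux
      unfolding hermite by blast
  next
    case laguerre
    have "mutually_intertwined w2 w1" if "intertwiners w1 w2 \<noteq> {\<lambda>p. 0}"
      using nonzero_intertwiner_obtains[OF that] laguerre_intertwiner laguerre_integer_difference laguerre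
      by metis
    moreover have "interval w1 = interval w2" by (simp add: laguerre laguerre_weight_def)
    ultimately show ?thesis
      using Darboux_imp_intertwiner[OF classical_weight_laguerre classical_weight_laguerre]
        mutually_intertwined_imp_Darboux laguerre by blast
  next
    case jacobi
    have "mutually_intertwined w2 w1" if "intertwiners w1 w2 \<noteq> {\<lambda>p. 0}"
      using nonzero_intertwiner_obtains[OF that] jacobi_intertwiner jacobi_integer_difference jacobi
      by metis
    moreover have "interval w1 = interval w2" by (simp add: jacobi jacobi_weight_def)
    ultimately show ?thesis
      using Darboux_imp_intertwiner[OF classical_weight_jacobi classical_weight_jacobi]
        mutually_intertwined_imp_Darboux jacobi by blast
  qed
qed

end
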